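(* Let $\ell\in\mathbb S^{d-1}$. If Kalikow's condition $(K)_\ell$ holds, then condition $(T)_\ell$ holds.
   Context: Model. Fix an integer $d>1$ and $\kappa\in(0,1/(4d)]$. Let $\mathcal P_\kappa=\{z\in\mathbb R^{2d}:\sum_{i=1}^{2d}z_i=1,\ z_i\ge 2\kappa\ \forall i\}$ and $\Omega=(\mathcal P_\kappa)^{\mathbb Z^d}$ with its product $\sigma$-algebra $\mathfrak F_\Omega$, and let $\mathbb P$ be a probability law on $\mathfrak F_\Omega$. For $\omega=(\omega(y,e))_{y\in\mathbb Z^d,\,e\in\mathbb Z^d,|e|=1}\in\Omega$, the quenched law $P_{x,\omega}$ is the law of the Markov chain $(X_n)_{n\ge0}$ on $\mathbb Z^d$ with $P_{x,\omega}[X_0=x]=1$ and $P_{x,\omega}[X_{n+1}=X_n+e\mid X_n]=\omega(X_n,e)$ for $|e|=1$; the annealed law is $P_x=\mathbb P\otimes P_{x,\omega}$ (semidirect product), with expectation $E_x$. For $V\subset\mathbb Z^d$, $\partial V=\{z\in\mathbb Z^d\setminus V:\exists y\in V,\ |z-y|_1\le1\}$, and $T_V=\inf\{n\ge0:X_n\notin V\}$. $\mathbb S^{d-1}$ is the Euclidean unit sphere. Kalikow's condition. For a connected $V\subsetneq\mathbb Z^d$ with $0\in V$, Kalikow's chain is the Markov chain on $V\cup\partial V$ with transition probabilities $$\widehat P_V(x,x+e)=\frac{E_0\big[\sum_{n=0}^{T_V}\mathbf 1_{\{X_n=x\}}\omega(x,e)\big]}{E_0\big[\sum_{n=0}^{T_V}\mathbf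 1_{\{X_n=x\}}\big]}\quad(x\in V,\ |e|=1),\qquad \widehat P_V(x,x)=1\quad(x\in\partial V).$$ Let $\hat E_{x,V}$ be the expectation for this chain started at $x$, and $\hat d_V(x)=\hat E_{x,V}[X_1-X_0]$ the local drift. Condition $(K)_l$ (for $l\in\mathbb R^d\setminus\{0\}$) holds if there is a constant $\delta=\delta(l)>0$ such that $\inf_{V,\,x\in V}\hat d_V(x)\cdot l>\delta$, the infimum being over all connected strict subsets $V$ of $\mathbb Z^d$ with $0\in V$ and all $x\in V$. Condition $(T)$. For $L,L'>0$, $u\in\mathbb S^{d-1}$, $x\in\mathbb Z^d$, let $B_{L,L',u}(x)=\big(x+R_u((-L,L)\times(-L',L')^{d-1})\big)\cap\mathbb Z^d$, where $R_u$ is a fixed rotation of $\mathbb R^d$ with $R_u(e_1)=u$, and $\partial^+B_{L,L',u}(x)=\partial B_{L,L',u}(x)\cap\{y:(y-x)\cdot u\ge L\}$. Condition $(T)_\ell$ holds if there is $\mathfrak r>0$ with $$\limsup_{M\to\infty}M^{-1}\log P_0\big[X_{T_{B_{M,\mathfrak rM,\ell}(0)}}\notin\partial^+B_{M,\mathfrak rM,\ell}(0)\big]<0.$$ *)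

theory Defs
  imports "HOL-Probability.Probability"
begin

section \<open>The lattice\<close>

text \<open>Points of $\mathbb{Z}^d$ are elements of \<^typ>\<open>int ^ 'd\<close>, with $d$ = \<open>CARD('d)\<close>.\<close>

definition of_lattice :: "int ^ 'd \<Rightarrow> real ^ 'd" where
  "of_lattice z = (\<chi> i. real_of_int (z $ i))"

definition unit_steps :: "(int ^ 'd) set" where
  "unit_steps = {e. norm (of_lattice e) = 1}"

definition norm1 :: "int ^ 'd \<Rightarrow> int" where
  "norm1 z = (\<Sum>i\<in>UNIV. \<bar>z $ i\<bar>)"

definition boundary :: "(int ^ 'd) set \<Rightarrow> (int ^ 'd) set" where
  "boundary V = {z. z \<notin> V \<and> (\<exists>y\<in>V. norm1 (z - y) \<le> 1)}"

definition lattice_connected :: "(int ^ 'd) set \<Rightarrow> bool" where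
  "lattice_connected V \<longleftrightarrow>
     (\<forall>x\<in>V. \<forall>y\<in>V. (x, y) \<in> {(a, b). a \<in> V \<and> b \<in> V \<and> b - a \<in> unit_steps}\<^sup>*)"


section \<open>Environments\<close>

type_synonym 'd env = "int ^ 'd \<Rightarrow> int ^ 'd \<Rightarrow> real"

text \<open>The simplex $\mathcal{P}_\kappa$. Its $2d$ coordinates are labelled by the unit vectors of
  $\mathbb{Z}^d$ rather than by $1,\dots,2d$.\<close>

definition site_simplex :: "real \<Rightarrow> (int ^ 'd \<Rightarrow> real) set" where
  "site_simplex \<kappa> =
     {z \<in> unit_steps \<rightarrow>\<^sub>E UNIV. (\<Sum>e\<in>unit_steps. z e) = 1 \<and> (\<forall>e\<in>unit_steps. z e \<ge> 2 * \<kappa>)}"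

definition site_space :: "real \<Rightarrow> (int ^ 'd \<Rightarrow> real) measure" where
  "site_space \<kappa> = restrict_space (PiM unit_steps (\<lambda>_. borel)) (site_simplex \<kappa>)"

text \<open>Only the space and the $\sigma$-algebra of \<open>env_space\<close> are relevant: they are $\Omega$ and
  $\mathfrak{F}_\Omega$.\<close>

definition env_space :: "real \<Rightarrow> 'd::finite env measure" where
  "env_space \<kappa> = PiM UNIV (\<lambda>_. site_space \<kappa>)"


section \<open>Quenched and annealed laws\<close>

abbreviation path_space :: "(nat \<Rightarrow> 'a) measure" where
  "path_space \<equiv> PiM UNIV (\<lambda>_. count_space UNIV)"

text \<open>The law on path space of the Markov chain with transition probabilities \<open>p\<close> started at \<open>x\<close>,
  obtained from the Ionescu-Tulcea theorem: coordinate $0$ has law $\delta_x$, and given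
  coordinates $0,\dots,n$ coordinate $n+1$ has law $p(X_n,\cdot)$. See \<open>emeasure_markov_law\<close> below
  for the resulting finite-dimensional distributions.\<close>

definition markov_kernel :: "('a \<Rightarrow> 'a \<Rightarrow> real) \<Rightarrow> 'a \<Rightarrow> nat \<Rightarrow> (nat \<Rightarrow> 'a) \<Rightarrow> 'a measure" where
  "markov_kernel p x n s =
     (case n of 0 \<Rightarrow> return (count_space UNIV) x
      | Suc m \<Rightarrow> density (count_space UNIV) (\<lambda>y. ennreal (p (s m) y)))"

definition markov_law :: "('a \<Rightarrow> 'a \<Rightarrow> real) \<Rightarrow> 'a \<Rightarrow> (nat \<Rightarrow> 'a) measure" where
  "markov_law p x =
     projective_family.lim UNIV (Ionescu_Tulcea.CI (markov_kernel p x) (\<lambda>_. count_space UNIV))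
       (\<lambda>_. count_space UNIV)"

lemma Ionescu_Tulcea_markov_kernel:
  assumes "\<And>x. (\<integral>\<^sup>+ y. ennreal (p x y) \<partial>count_space UNIV) = 1"
  shows "Ionescu_Tulcea (markov_kernel p x) (\<lambda>_. count_space UNIV)"
proof (rule Ionescu_Tulcea.intro)
  have prob: "prob_space (density (count_space UNIV) (\<lambda>y. ennreal (p z y)))" for z
    by (rule prob_spaceI) (simp add: emeasure_density assms)
  fix n
  show "markov_kernel p x n \<in> measurable (PiM {0..<n} (\<lambda>_. count_space UNIV)) (subprob_algebra (count_space UNIV))"
  proof (cases n)
    case 0
    then show ?thesis
      by (simp add: markov_kernel_def[abs_def] space_subprob_algebra subprob_space_return)
  next
    case (Suc m)
    have *: "(\<lambda>z. density (count_space UNIV) (\<lambda>y. ennreal (p z y)))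
            \<in> measurable (count_space UNIV) (subprob_algebra (count_space UNIV))"
      using prob by (auto simp: space_subprob_algebra intro: prob_space_imp_subprob_space)
    have "(\<lambda>s. s m) \<in> measurable (PiM {0..<n} (\<lambda>_. count_space UNIV)) (count_space UNIV)"
      using Suc by (intro measurable_component_singleton) simp
    from measurable_compose[OF this *] show ?thesis
      using Suc by (simp add: markov_kernel_def[abs_def])
  qed
  fix s
  show "prob_space (markov_kernel p x n s)"
    using prob by (cases n) (auto simp: markov_kernel_def intro: prob_space_return)
qed

lemma emeasure_markov_law:
  assumes "\<And>x. (\<integral>\<^sup>+ y. ennreal (p x y) \<partial>count_space UNIV) = 1"
  shows "emeasure (markov_law p x) {s. \<forall>i\<le>n. s i = a i} =
           (if a 0 = x then (\<Prod>i<n. ennreal (p (a i) (a (Suc i)))) else 0)"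
proof -
  let ?M = "\<lambda>_::nat. count_space (UNIV :: 'a set)"
  interpret IT: Ionescu_Tulcea "markov_kernel p x" ?M
    by (rule Ionescu_Tulcea_markov_kernel) (rule assms)
  let ?u = "\<lambda>_::nat. undefined :: 'a"
  define X where "X n = (\<Pi>\<^sub>E i\<in>{0..<n}. {a i})" for n :: nat
  have X[measurable]: "X n \<in> sets (PiM {0..<n} ?M)" for n
    unfolding X_def by (rule sets_PiM_I_finite) auto
  have u: "?u \<in> space (PiM {0..<0} ?M)"
    by (simp add: space_PiM)
  have step: "emeasure (IT.C 0 (Suc n) ?u) (X (Suc n)) =
      emeasure (IT.C 0 n ?u) (X n) * emeasure (markov_kernel p x n (restrict a {0..<n})) {a n}" for n
  proof -
    have ne: "space (IT.C 0 n ?u) \<noteq> {}"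
      using IT.prob_space_C[OF u, THEN prob_space.not_empty] .
    have "emeasure (IT.C 0 (Suc n) ?u) (X (Suc n)) =
        (\<integral>\<^sup>+ w. emeasure (IT.eP n w) (X (Suc n)) \<partial>IT.C 0 n ?u)"
      using ne IT.measurable_eP[of n] IT.sets_C[OF u, of n]
      by (simp, subst emeasure_bind[where N="PiM {0..<Suc n} ?M"])
         (auto simp: measurable_cong_sets[OF IT.sets_C[OF u, of n] refl])
    also have "\<dots> = (\<integral>\<^sup>+ w. emeasure (markov_kernel p x n (restrict a {0..<n})) {a n} *
        indicator (X n) w \<partial>IT.C 0 n ?u)"
    proof (rule nn_integral_cong)
      fix w assume "w \<in> space (IT.C 0 n ?u)"
      then have w: "w \<in> space (PiM {0..<n} ?M)" by (simp add: IT.space_C[OF u])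
      have "(\<lambda>y. w(n := y)) -` X (Suc n) = (if w \<in> X n then {a n} else {})"
        using w by (auto simp: X_def PiE_iff space_PiM Ball_def less_Suc_eq extensional_def
            split: if_splits)
      moreover have "w = restrict a {0..<n}" if "w \<in> X n"
        using that by (auto simp: X_def PiE_iff extensional_def fun_eq_iff)
      ultimately show "emeasure (IT.eP n w) (X (Suc n)) =
          emeasure (markov_kernel p x n (restrict a {0..<n})) {a n} * indicator (X n) w"
        by (auto simp: IT.emeasure_eP[OF w X])
    qed
    also have "\<dots> = emeasure (markov_kernel p x n (restrict a {0..<n})) {a n} *
        emeasure (IT.C 0 n ?u) (X n)"
      by (rule nn_integral_cmult_indicator) (simp add: IT.sets_C[OF u])
    finally show ?thesis by (simp add: mult.commute)
  qed
  have C: "emeasure (IT.C 0 (Suc n) ?u) (X (Suc n)) =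
      (if a 0 = x then (\<Prod>i<n. ennreal (p (a i) (a (Suc i)))) else 0)" for n
  proof (induction n)
    case 0
    have "?u \<in> X 0" by (simp add: X_def)
    moreover have "X 0 \<in> sets (PiM {0..<0} ?M)" by (rule X)
    ultimately have "emeasure (IT.C 0 0 ?u) (X 0) = 1"
      by simp
    then show ?case
      by (subst step) (auto simp: markov_kernel_def)
  next
    case (Suc n)
    have "emeasure (markov_kernel p x (Suc n) (restrict a {0..<Suc n})) {a (Suc n)} =
        ennreal (p (a n) (a (Suc n)))"
      by (simp add: markov_kernel_def emeasure_density nn_integral_indicator_singleton)
    with Suc show ?case
      by (subst step) (simp del: IT.C.simps)
  qed
  have "{s. \<forall>i\<le>n. s i = a i} = prod_emb UNIV ?M {0..<Suc n} (X (Suc n))"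
    by (auto simp: prod_emb_def X_def space_PiM PiE_iff extensional_def restrict_def less_Suc_eq_le)
  moreover have "prod_emb {0..<Suc n} ?M {0..<Suc n} (X (Suc n)) = X (Suc n)"
    by (rule prod_emb_id) (auto simp: X_def PiE_iff)
  ultimately show ?thesis
    using C[of n] unfolding markov_law_def
    by (simp only: IT.lim[OF finite_atLeastLessThan X] IT.emeasure_CI[OF order_refl X])
qed

definition env_transition :: "'d::finite env \<Rightarrow> int ^ 'd \<Rightarrow> int ^ 'd \<Rightarrow> real" where
  "env_transition \<omega> x y = (if y - x \<in> unit_steps then \<omega> x (y - x) else 0)"

definition quenched :: "int ^ 'd \<Rightarrow> 'd env \<Rightarrow> (nat \<Rightarrow> int ^ 'd) measure" where
  "quenched x \<omega> = markov_law (env_transition \<omega>) x"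

definition annealed :: "'d::finite env measure \<Rightarrow> int ^ 'd \<Rightarrow> ('d env \<times> (nat \<Rightarrow> int ^ 'd)) measure" where
  "annealed P x =
     P \<bind> (\<lambda>\<omega>. quenched x \<omega> \<bind> (\<lambda>s. return (P \<Otimes>\<^sub>M path_space) (\<omega>, s)))"

definition exit_time :: "'a set \<Rightarrow> (nat \<Rightarrow> 'a) \<Rightarrow> enat" where
  "exit_time V s = (INF n\<in>{n. s n \<notin> V}. enat n)"


section \<open>Kalikow's condition\<close>

definition kalikow_num :: "'d::finite env measure \<Rightarrow> (int ^ 'd) set \<Rightarrow> int ^ 'd \<Rightarrow> int ^ 'd \<Rightarrow> ennreal" where
  "kalikow_num P V x e =
     (\<integral>\<^sup>+(\<omega>, s). (\<Sum>n. if enat n \<le> exit_time V s then indicator {x} (s n) * ennreal (\<omega> x e) else 0)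
        \<partial>annealed P 0)"

definition kalikow_den :: "'d::finite env measure \<Rightarrow> (int ^ 'd) set \<Rightarrow> int ^ 'd \<Rightarrow> ennreal" where
  "kalikow_den P V x =
     (\<integral>\<^sup>+(\<omega>, s). (\<Sum>n. if enat n \<le> exit_time V s then indicator {x} (s n) else 0)
        \<partial>annealed P 0)"

text \<open>Kalikow's chain lives on $V \cup \partial V$ and is absorbed on $\partial V$. To have a chain on
  all of $\mathbb{Z}^d$, the remaining points are made absorbing as well; they are never reached
  from $V$.\<close>

definition kalikow_transition ::
  "'d::finite env measure \<Rightarrow> (int ^ 'd) set \<Rightarrow> int ^ 'd \<Rightarrow> int ^ 'd \<Rightarrow> real" where
  "kalikow_transition P V x y =
     (if x \<in> V then
        if y - x \<in> unit_steps then enn2real (kalikow_num P V x (y - x) / kalikow_den P V x) else 0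
      else if y = x then 1 else 0)"

definition kalikow_drift :: "'d::finite env measure \<Rightarrow> (int ^ 'd) set \<Rightarrow> int ^ 'd \<Rightarrow> real ^ 'd" where
  "kalikow_drift P V x =
     (\<integral>s. of_lattice (s 1 - s 0) \<partial>markov_law (kalikow_transition P V) x)"

definition kalikow_condition :: "'d::finite env measure \<Rightarrow> real ^ 'd \<Rightarrow> bool" where
  "kalikow_condition P l \<longleftrightarrow>
     (\<exists>\<delta>>0. (INF (V, x)\<in>{(V, x). lattice_connected V \<and> V \<subset> UNIV \<and> 0 \<in> V \<and> x \<in> V}.
               ereal (kalikow_drift P V x \<bullet> l)) > ereal \<delta>)"


section \<open>Condition (T)\<close>

text \<open>The coordinate \<open>k\<close> plays the role of the first coordinate, so $e_1$ is \<open>axis k 1\<close>, and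
  \<open>R u\<close> is the matrix of the rotation $R_u$.\<close>

definition lattice_box ::
  "'d::finite \<Rightarrow> (real ^ 'd \<Rightarrow> real ^ 'd ^ 'd) \<Rightarrow> real \<Rightarrow> real \<Rightarrow> real ^ 'd \<Rightarrow> int ^ 'd \<Rightarrow> (int ^ 'd) set" where
  "lattice_box k R L L' u x =
     {z. \<exists>w. w $ k \<in> {-L<..<L} \<and> (\<forall>j. j \<noteq> k \<longrightarrow> w $ j \<in> {-L'<..<L'}) \<and>
             of_lattice z = of_lattice x + R u *v w}"

definition front_boundary ::
  "'d::finite \<Rightarrow> (real ^ 'd \<Rightarrow> real ^ 'd ^ 'd) \<Rightarrow> real \<Rightarrow> real \<Rightarrow> real ^ 'd \<Rightarrow> int ^ 'd \<Rightarrow> (int ^ 'd) set" where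
  "front_boundary k R L L' u x =
     boundary (lattice_box k R L L' u x) \<inter> {y. of_lattice (y - x) \<bullet> u \<ge> L}"

text \<open>Paths that never leave the box (a null set, as the box is finite) count as not exiting through
  the front.\<close>

definition exits_through :: "'a set \<Rightarrow> 'a set \<Rightarrow> (nat \<Rightarrow> 'a) \<Rightarrow> bool" where
  "exits_through V F s \<longleftrightarrow> (\<exists>n. exit_time V s = enat n \<and> s n \<in> F)"

definition bad_exit_prob ::
  "'d::finite env measure \<Rightarrow> 'd \<Rightarrow> (real ^ 'd \<Rightarrow> real ^ 'd ^ 'd) \<Rightarrow> real \<Rightarrow> real \<Rightarrow> real ^ 'd \<Rightarrow> real" where
  "bad_exit_prob P k R L L' u =
     \<P>((\<omega>, s) in annealed P 0. \<not> exits_through (lattice_box k R L L' u 0) (front_boundary k R L L' u 0) s)"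

text \<open>Logarithm with $\log 0 = -\infty$ (whereas \<open>ln 0 = 0\<close> on the reals).\<close>

definition ln_ereal :: "real \<Rightarrow> ereal" where
  "ln_ereal p = (if p = 0 then -\<infinity> else ereal (ln p))"

definition condition_T ::
  "'d::finite env measure \<Rightarrow> 'd \<Rightarrow> (real ^ 'd \<Rightarrow> real ^ 'd ^ 'd) \<Rightarrow> real ^ 'd \<Rightarrow> bool" where
  "condition_T P k R u \<longleftrightarrow>
     (\<exists>r>0. Limsup at_top (\<lambda>M::real. ereal (1 / M) * ln_ereal (bad_exit_prob P k R M (r * M) u)) < 0)"

end

theory Submission
  imports Defs
begin

text \<open>Let \<open>V\<close> be a finite connected set containing the origin. For a function \<open>F\<close> on the lattice, the
  expectation of \<open>F\<close> at the annealed exit point of \<open>V\<close> is \<open>F 0\<close> plus the sum over \<open>x\<close> in \<open>V\<close> of the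
  annealed Green function at \<open>x\<close> times the mean increment of \<open>F\<close> under one step of Kalikow's chain
  from \<open>x\<close>. Hence this expectation is at most \<open>F 0\<close> whenever \<open>F\<close> is superharmonic for Kalikow's
  chain. A drift of at least \<open>\<delta>\<close> in direction \<open>l\<close> makes
  \<open>exp ((a *\<^sub>R v - c *\<^sub>R l) \<bullet> x)\<close> superharmonic for unit vectors \<open>v\<close> (and \<open>v = 0\<close>), \<open>c = \<delta> / 8\<close> and
  \<open>a = c * \<delta> / 2\<close>. In a box of length \<open>M\<close> and width \<open>2 * c / a * M\<close> such a function, with \<open>v = 0\<close> for
  the back and \<open>v\<close> normal to the face for a side, is at least \<open>exp (c * M)\<close> at every exit point off the
  front, so such an exit has annealed probability of order \<open>exp (- c * M)\<close>.\<close>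

section \<open>Markov laws as measurable functions of their transition probabilities\<close>

lemma prob_space_markov_law:
  fixes p :: "'a \<Rightarrow> 'a \<Rightarrow> real"
  assumes "\<And>x. (\<integral>\<^sup>+ y. ennreal (p x y) \<partial>count_space UNIV) = 1"
  shows "prob_space (markov_law p x)" and "sets (markov_law p x) = sets path_space"
proof -
  let ?M = "\<lambda>_::nat. count_space (UNIV :: 'a set)"
  interpret IT: Ionescu_Tulcea "markov_kernel p x" ?M
    by (rule Ionescu_Tulcea_markov_kernel) (rule assms)
  \<comment> \<open>The projective limit is specified on finite index sets. The empty one already
    fixes the total mass, as its cylinder is the whole path space.\<close>
  have "emeasure (IT.CI {}) (space (PiM {} ?M)) = 1"
    using prob_space.emeasure_space_1[OF IT.PF.prob_space_P[of "{}"]] by (simp only: IT.PF.space_P) simp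
  then have *: "emeasure (markov_law p x) (prod_emb UNIV ?M {} (space (PiM {} ?M))) = 1"
    unfolding markov_law_def by (subst IT.lim) auto
  show "sets (markov_law p x) = sets path_space"
    unfolding markov_law_def by simp
  then have "space (markov_law p x) = space path_space"
    by (rule sets_eq_imp_space_eq)
  with * show "prob_space (markov_law p x)"
    by (intro prob_spaceI) (auto simp: prod_emb_def space_PiM restrict_def)
qed

lemma space_path_space: "space path_space = UNIV"
  by (simp add: space_PiM)

lemma coordinate_sets: "{s. s i \<in> A} \<in> sets path_space"
  using measurable_sets[OF measurable_component_singleton[of i UNIV "\<lambda>_. count_space UNIV"], of A]
  by (simp add: space_path_space vimage_def)

lemma coordinates_sets: "{s. \<forall>i\<le>n. s i \<in> A i} \<in> sets path_space"
proof -
  have "(\<Inter>i\<le>n. {s. s i \<in> A i}) \<in> sets path_space"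
    by (intro sets.finite_INT coordinate_sets) simp_all
  moreover have "(\<Inter>i\<le>n. {s. s i \<in> A i}) = {s. \<forall>i\<le>n. s i \<in> A i}"
    by auto
  ultimately show ?thesis
    by (simp only:)
qed

lemma cylinder_sets: "{s. \<forall>i\<le>n. s i = a i} \<in> sets path_space"
  using coordinates_sets[of n "\<lambda>i. {a i}"] by (simp only: singleton_iff)

text \<open>Over a countable state space, an event about one coordinate is a countable union of
  cylinders that fix a whole initial segment, and \<open>emeasure_markov_law\<close> evaluates
  exactly such cylinders. The empty set is added to make the generator stable under
  intersection.\<close>

lemma sets_path_space_cylinders:
  "sets (path_space :: (nat \<Rightarrow> 'a::countable) measure) =
     sigma_sets UNIV (insert {} (\<Union>n. range (\<lambda>a. {s. \<forall>i\<le>n. s i = a i})))"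
  (is "_ = sigma_sets UNIV ?G")
proof
  have "sets (path_space :: (nat \<Rightarrow> 'a) measure) \<subseteq> sets (sigma UNIV ?G)"
  proof (rule sets_PiM_in_sets)
    show "space (sigma UNIV ?G) = (\<Pi>\<^sub>E i\<in>UNIV. space (count_space (UNIV :: 'a set)))"
      by (simp add: PiE_UNIV_domain)
  next
    fix i and A :: "'a set"
    \<comment> \<open>Lists, unlike functions on the naturals, form a countable type, so indexing
      initial segments by lists keeps the union countable.\<close>
    let ?L = "{xs :: 'a list. length xs = Suc i \<and> xs ! i \<in> A}"
    have "{x \<in> space (sigma UNIV ?G). x i \<in> A} = (\<Union>xs\<in>?L. {s. \<forall>j\<le>i. s j = xs ! j})"
      (is "?l = ?r")
    proof (intro equalityI subsetI)
      fix s assume "s \<in> ?l"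
      then show "s \<in> ?r"
        by (intro UN_I[of "map s [0..<Suc i]"]) (auto simp: nth_append simp del: upt_Suc)
    qed auto
    also have "\<dots> \<in> sigma_sets UNIV ?G"
    proof (rule sigma_sets_UNION)
      show "countable ((\<lambda>xs. {s. \<forall>j\<le>i. s j = xs ! j}) ` ?L)"
        by (rule countable_image) (rule countableI_type)
      fix X assume "X \<in> (\<lambda>xs. {s. \<forall>j\<le>i. s j = xs ! j}) ` ?L"
      then obtain xs where X: "X = {s. \<forall>j\<le>i. s j = xs ! j}" by (rule imageE)
      have "X \<in> ?G"
        unfolding X by (intro insertI2 UN_I[of i] UNIV_I range_eqI[of _ _ "\<lambda>j. xs ! j"] refl)
      then show "X \<in> sigma_sets UNIV ?G"
        by (rule sigma_sets.Basic)
    qed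
    finally show "{x \<in> space (sigma UNIV ?G). x i \<in> A} \<in> sets (sigma UNIV ?G)"
      by simp
  qed
  then show "sets (path_space :: (nat \<Rightarrow> 'a) measure) \<subseteq> sigma_sets UNIV ?G"
    by simp
  have "?G \<subseteq> sets path_space"
    using cylinder_sets by auto
  then show "sigma_sets UNIV ?G \<subseteq> sets path_space"
    using sets.sigma_sets_subset[of ?G path_space] by (simp add: space_path_space)
qed

text \<open>It suffices to test a generating system stable under intersection, and the mass of an
  initial-segment cylinder is a finite product of transition probabilities.\<close>

lemma measurable_markov_law:
  fixes p :: "'b \<Rightarrow> 'a::countable \<Rightarrow> 'a \<Rightarrow> real"
  assumes stoch: "\<And>w x. w \<in> space M \<Longrightarrow> (\<integral>\<^sup>+ y. ennreal (p w x y) \<partial>count_space UNIV) = 1"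
    and meas: "\<And>x y. (\<lambda>w. p w x y) \<in> borel_measurable M"
  shows "(\<lambda>w. markov_law (p w) x) \<in> measurable M (subprob_algebra path_space)"
proof (rule measurable_subprob_algebra_generated[OF sets_path_space_cylinders])
  let ?c = "\<lambda>n a. {s :: nat \<Rightarrow> 'a. \<forall>i\<le>n. s i = a i}"
  let ?G = "insert {} (\<Union>n. range (?c n))"
  have G: "?c n a \<in> ?G" for n a
    by (intro insertI2 UN_I[of n] rangeI) simp
  have *: "?c m a \<inter> ?c n b \<in> ?G" if "m \<le> n" for m n a b
  proof (cases "\<forall>i\<le>m. a i = b i")
    case True
    then have "?c m a \<inter> ?c n b = ?c n b" using that by auto
    then show ?thesis using G by simp
  next
    case False
    then have "?c m a \<inter> ?c n b = {}" using that by force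
    then show ?thesis by simp
  qed
  have **: "?c m a \<inter> ?c n b \<in> ?G" for m n a b
    using *[of m n a b] *[of n m b a] unfolding Int_commute[of "?c n b"] by (rule le_cases)
  show "Int_stable ?G"
  proof (rule Int_stableI)
    fix X Y assume "X \<in> ?G" "Y \<in> ?G"
    then consider "X \<inter> Y = {}" | m n a b where "X = ?c m a" "Y = ?c n b" by auto
    then show "X \<inter> Y \<in> ?G"
      by cases (simp, simp only: **)
  qed
  show "?G \<subseteq> Pow UNIV" by simp
  fix w assume "w \<in> space M"
  from prob_space_markov_law[OF stoch[OF this]]
  show "subprob_space (markov_law (p w) x)" "sets (markov_law (p w) x) = sets path_space"
    by (auto intro: prob_space_imp_subprob_space)
next
  fix A :: "(nat \<Rightarrow> 'a) set"
  assume "A \<in> insert {} (\<Union>n. range (\<lambda>a. {s. \<forall>i\<le>n. s i = a i}))"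
  then consider "A = {}" | n a where "A = {s. \<forall>i\<le>n. s i = a i}" by auto
  then show "(\<lambda>w. emeasure (markov_law (p w) x) A) \<in> borel_measurable M"
  proof cases
    case 1
    show ?thesis
      unfolding 1 emeasure_empty by simp
  next
    case 2
    have "emeasure (markov_law (p w) x) A =
        (if a 0 = x then \<Prod>i<n. ennreal (p w (a i) (a (Suc i))) else 0)" if "w \<in> space M" for w
      unfolding 2 by (rule emeasure_markov_law) (rule stoch[OF that])
    moreover have "(\<lambda>w. if a 0 = x then \<Prod>i<n. ennreal (p w (a i) (a (Suc i))) else 0) \<in> borel_measurable M"
      using meas by (cases "a 0 = x") simp_all
    ultimately show ?thesis
      by (rule measurable_cong[THEN iffD2, of M "\<lambda>w. emeasure (markov_law (p w) x) A"])
  qed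
next
  have "emeasure (markov_law (p w) x) UNIV = 1" if "w \<in> space M" for w
    using prob_space.emeasure_space_1[OF prob_space_markov_law(1)[OF stoch[OF that]]]
    unfolding sets_eq_imp_space_eq[OF prob_space_markov_law(2)[OF stoch[OF that]]] space_path_space .
  then show "(\<lambda>w. emeasure (markov_law (p w) x) UNIV) \<in> borel_measurable M"
    by (rule measurable_cong[THEN iffD2]) simp_all
qed

section \<open>Paths that have not yet left a set\<close>

definition staying :: "'a set \<Rightarrow> nat \<Rightarrow> 'a \<Rightarrow> (nat \<Rightarrow> 'a) set" where
  "staying V n x = {s. (\<forall>i\<le>n. s i \<in> V) \<and> s n = x}"

lemma staying_sets: "staying V n x \<in> sets path_space"
proof -
  have "staying V n x = {s. \<forall>i\<le>n. s i \<in> V} \<inter> {s. s n \<in> {x}}"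
    by (auto simp: staying_def)
  then show ?thesis
    by (simp only: sets.Int coordinates_sets coordinate_sets)
qed

lemma staying_step_sets: "{s \<in> staying V n x. s m = y} \<in> sets path_space"
proof -
  have "{s \<in> staying V n x. s m = y} = staying V n x \<inter> {s. s m \<in> {y}}"
    by auto
  then show ?thesis
    by (simp only: sets.Int staying_sets coordinate_sets)
qed

text \<open>The Markov property at time \<open>n\<close>. For finite \<open>V\<close> the event
  splits into finitely many disjoint cylinders, and prolonging each of them by \<open>y\<close>
  contributes the same factor \<open>p x y\<close>.\<close>

lemma emeasure_markov_law_staying_step:
  fixes p :: "'a \<Rightarrow> 'a \<Rightarrow> real"
  assumes stoch: "\<And>x. (\<integral>\<^sup>+ y. ennreal (p x y) \<partial>count_space UNIV) = 1"
    and V: "finite V"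
  shows "emeasure (markov_law p z) {s \<in> staying V n x. s (Suc n) = y} =
           emeasure (markov_law p z) (staying V n x) * ennreal (p x y)"
proof -
  \<comment> \<open>Extensionality on \<open>{..n}\<close> leaves one representative per initial
    segment, which makes the cylinders disjoint.\<close>
  define A where "A = {a \<in> {..n} \<rightarrow>\<^sub>E V. a n = x}"
  have A: "finite A"
    unfolding A_def using V by (auto intro: finite_PiE finite_subset[of _ "{..n} \<rightarrow>\<^sub>E V"])
  let ?c = "\<lambda>n a. {s. \<forall>i\<le>n. s i = a i}"
  let ?e = "\<lambda>a. a(Suc n := y)"
  have restr: "s \<in> staying V n x \<longleftrightarrow> restrict s {..n} \<in> A" for s
    by (auto simp: staying_def A_def)
  have eq: "a = restrict s {..n}" if "a \<in> A" "s \<in> ?c n a" for a s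
    using that by (auto simp: A_def PiE_iff extensional_def fun_eq_iff)
  have s1: "staying V n x = (\<Union>a\<in>A. ?c n a)"
  proof (intro equalityI subsetI)
    fix s assume "s \<in> staying V n x"
    then show "s \<in> (\<Union>a\<in>A. ?c n a)"
      by (intro UN_I[of "restrict s {..n}"]) (auto simp: restr)
  next
    fix s assume "s \<in> (\<Union>a\<in>A. ?c n a)"
    then obtain a where a: "a \<in> A" "s \<in> ?c n a" by (rule UN_E)
    from eq[OF a] a(1) show "s \<in> staying V n x"
      by (simp add: restr)
  qed
  have c: "?c (Suc n) (?e a) = {s \<in> ?c n a. s (Suc n) = y}" for a
    by (auto simp: le_Suc_eq)
  have s2: "{s \<in> staying V n x. s (Suc n) = y} = (\<Union>a\<in>A. ?c (Suc n) (?e a))"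
    unfolding s1 c by (intro set_eqI) simp
  have d1: "disjoint_family_on (\<lambda>a. ?c n a) A"
    unfolding disjoint_family_on_def
  proof (intro ballI impI equals0I)
    fix a b s assume *: "a \<in> A" "b \<in> A" "a \<noteq> b" "s \<in> ?c n a \<inter> ?c n b"
    have "a = restrict s {..n}" "b = restrict s {..n}"
      by (rule eq, use * in blast, use * in blast)+
    with *(3) show False by metis
  qed
  have d2: "disjoint_family_on (\<lambda>a. ?c (Suc n) (?e a)) A"
    unfolding disjoint_family_on_def c
  proof (intro ballI impI equals0I)
    fix a b s assume *: "a \<in> A" "b \<in> A" "a \<noteq> b"
      "s \<in> {s \<in> ?c n a. s (Suc n) = y} \<inter> {s \<in> ?c n b. s (Suc n) = y}"
    have "a = restrict s {..n}" "b = restrict s {..n}"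
      by (rule eq, use * in blast, use * in blast)+
    with *(3) show False by metis
  qed
  have m: "(\<lambda>a. ?c k (f a)) ` A \<subseteq> sets (markov_law p z)" for f :: "(nat \<Rightarrow> 'a) \<Rightarrow> nat \<Rightarrow> 'a" and k
    unfolding prob_space_markov_law(2)[OF stoch] by (intro image_subsetI cylinder_sets)
  have "emeasure (markov_law p z) {s \<in> staying V n x. s (Suc n) = y} =
      (\<Sum>a\<in>A. emeasure (markov_law p z) (?c (Suc n) (?e a)))"
    unfolding s2 by (rule sum_emeasure[OF m d2 A, symmetric])
  also have "\<dots> = (\<Sum>a\<in>A. emeasure (markov_law p z) (?c n a) * ennreal (p x y))"
  proof (intro sum.cong refl)
    fix a assume "a \<in> A"
    then have a: "a n = x" by (simp add: A_def)
    have "(\<Prod>i<n. ennreal (p (?e a i) (?e a (Suc i)))) = (\<Prod>i<n. ennreal (p (a i) (a (Suc i))))"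
      by (intro prod.cong) auto
    then show "emeasure (markov_law p z) (?c (Suc n) (?e a)) =
        emeasure (markov_law p z) (?c n a) * ennreal (p x y)"
      using a by (subst (1 2) emeasure_markov_law[OF stoch]) auto
  qed
  also have "\<dots> = emeasure (markov_law p z) (staying V n x) * ennreal (p x y)"
    unfolding s1 sum_emeasure[OF m d1 A, symmetric] by (simp only: sum_distrib_right)
  finally show ?thesis .
qed

section \<open>Unit steps and bounded sets of lattice points\<close>

lemma norm_of_lattice_power2: "(norm (of_lattice z))\<^sup>2 = real_of_int (\<Sum>i\<in>UNIV. (z $ i)\<^sup>2)"
  by (simp add: of_lattice_def norm_vec_def L2_set_def sum_nonneg)

lemma unit_steps_iff: "e \<in> unit_steps \<longleftrightarrow> (\<Sum>i\<in>UNIV. (e $ i)\<^sup>2) = 1"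
proof -
  have "e \<in> unit_steps \<longleftrightarrow> (norm (of_lattice e))\<^sup>2 = 1"
    by (simp add: unit_steps_def power2_eq_1_iff) (smt (verit) norm_ge_zero)
  then show ?thesis
    unfolding norm_of_lattice_power2 by linarith
qed

text \<open>An integer is bounded in absolute value by its square. The bound places the endpoint of
  a step out of a set in the \<open>boundary\<close> of that set.\<close>

lemma norm1_unit_steps: "e \<in> unit_steps \<Longrightarrow> norm1 e \<le> 1"
proof -
  assume e: "e \<in> unit_steps"
  have "\<bar>a\<bar> \<le> a\<^sup>2" for a :: int
  proof (cases "a = 0")
    case False
    then have "\<bar>a\<bar> * 1 \<le> \<bar>a\<bar> * \<bar>a\<bar>"
      by (intro mult_left_mono) auto
    then show ?thesis by (simp add: power2_eq_square)
  qed simp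
  then have "norm1 e \<le> (\<Sum>i\<in>UNIV. (e $ i)\<^sup>2)"
    unfolding norm1_def by (intro sum_mono)
  with e show ?thesis by (simp add: unit_steps_iff)
qed

lemma finite_lattice_bounded: "finite {z :: int ^ 'd::finite. \<forall>i. \<bar>z $ i\<bar> \<le> m}"
proof -
  have "finite (vec_nth ` {z :: int ^ 'd. \<forall>i. \<bar>z $ i\<bar> \<le> m})"
  proof (rule finite_subset)
    show "vec_nth ` {z :: int ^ 'd. \<forall>i. \<bar>z $ i\<bar> \<le> m} \<subseteq> UNIV \<rightarrow>\<^sub>E {-m..m}"
      by (auto simp: PiE_UNIV_domain abs_le_iff) (metis minus_le_iff)
    show "finite ((UNIV :: 'd set) \<rightarrow>\<^sub>E {-m..m})"
      by (intro finite_PiE) auto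
  qed
  then show ?thesis
    by (rule finite_imageD) (simp add: inj_on_def vec_nth_inject)
qed

lemma finite_unit_steps: "finite (unit_steps :: (int ^ 'd::finite) set)"
proof (rule finite_subset[OF _ finite_lattice_bounded])
  show "unit_steps \<subseteq> {z :: int ^ 'd. \<forall>i. \<bar>z $ i\<bar> \<le> 1}"
  proof safe
    fix e :: "int ^ 'd" and i assume "e \<in> unit_steps"
    then have "norm1 e \<le> 1" by (rule norm1_unit_steps)
    moreover have "\<bar>e $ i\<bar> \<le> norm1 e"
      unfolding norm1_def by (intro member_le_sum) auto
    ultimately show "\<bar>e $ i\<bar> \<le> 1" by simp
  qed
qed

lemma of_lattice_add: "of_lattice (x + y) = of_lattice x + of_lattice y"
  by (simp add: of_lattice_def vec_eq_iff)

lemma of_lattice_0 [simp]: "of_lattice 0 = 0"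
  by (simp add: of_lattice_def vec_eq_iff)

text \<open>The hypotheses concern the single site \<open>x\<close>, so that the lemma serves
  Kalikow's chain at sites of \<open>V\<close> as well as the quenched walk.\<close>

lemma env_transition_nn_integral:
  fixes \<omega> :: "'d::finite env"
  assumes "(\<Sum>e\<in>unit_steps. \<omega> x e) = 1" and "\<And>e. e \<in> unit_steps \<Longrightarrow> 0 \<le> \<omega> x e"
  shows "(\<integral>\<^sup>+ y. ennreal (env_transition \<omega> x y) \<partial>count_space UNIV) = 1"
proof -
  have "(\<integral>\<^sup>+ y. ennreal (env_transition \<omega> x y) \<partial>count_space UNIV) =
      (\<Sum>y\<in>(+) x ` unit_steps. ennreal (env_transition \<omega> x y))"
  proof (rule nn_integral_count_space')
    fix y assume y: "y \<notin> (+) x ` unit_steps"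
    have "y - x \<notin> unit_steps"
      using y image_eqI[of y "(+) x" "y - x" unit_steps] by auto
    then show "ennreal (env_transition \<omega> x y) = 0"
      by (simp add: env_transition_def)
  qed (auto simp: finite_unit_steps)
  also have "\<dots> = (\<Sum>e\<in>unit_steps. ennreal (\<omega> x e))"
    by (subst sum.reindex) (auto simp: env_transition_def)
  also have "\<dots> = 1"
    using assms by (simp add: sum_ennreal)
  finally show ?thesis .
qed

section \<open>The annealed law as an average of quenched laws\<close>

locale rwre = prob_space P for P :: "'d::finite env measure" +
  fixes \<kappa> :: real
  assumes sets_P: "sets P = sets (env_space \<kappa>)"
    and kappa_pos: "0 < \<kappa>"
begin

lemma env_site: "\<omega> \<in> space P \<Longrightarrow> \<omega> x \<in> site_simplex \<kappa>"
  by (auto simp: sets_eq_imp_space_eq[OF sets_P] env_space_def site_space_def space_PiM space_restrict_space)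

lemma env_sum: "\<omega> \<in> space P \<Longrightarrow> (\<Sum>e\<in>unit_steps. \<omega> x e) = 1"
  using env_site[of \<omega> x] by (simp add: site_simplex_def)

lemma env_ge: "\<omega> \<in> space P \<Longrightarrow> e \<in> unit_steps \<Longrightarrow> 2 * \<kappa> \<le> \<omega> x e"
  using env_site[of \<omega> x] by (simp add: site_simplex_def)

lemma env_nonneg: "\<omega> \<in> space P \<Longrightarrow> e \<in> unit_steps \<Longrightarrow> 0 \<le> \<omega> x e"
  using env_ge[of \<omega> e x] kappa_pos by linarith

lemma env_measurable: "e \<in> unit_steps \<Longrightarrow> (\<lambda>\<omega>. \<omega> x e) \<in> borel_measurable P"
proof -
  assume e: "e \<in> unit_steps"
  have 1: "(\<lambda>\<omega>. \<omega> x) \<in> measurable (env_space \<kappa>) (site_space \<kappa>)"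
    unfolding env_space_def by (rule measurable_component_singleton) simp
  have 2: "(\<lambda>f. f e) \<in> borel_measurable (site_space \<kappa>)"
    unfolding site_space_def by (intro measurable_restrict_space1 measurable_component_singleton e)
  show ?thesis
    using measurable_compose[OF 1 2] by (simp only: measurable_cong_sets[OF sets_P refl])
qed

lemma env_transition_stochastic:
  "\<omega> \<in> space P \<Longrightarrow> (\<integral>\<^sup>+ y. ennreal (env_transition \<omega> x y) \<partial>count_space UNIV) = 1"
  by (rule env_transition_nn_integral) (auto intro: env_sum env_nonneg)

lemma env_transition_measurable: "(\<lambda>\<omega>. env_transition \<omega> x y) \<in> borel_measurable P"
  using env_measurable[of "y - x" x] by (cases "y - x \<in> unit_steps") (auto simp: env_transition_def)

lemma quenched_measurable: "quenched x \<in> measurable P (subprob_algebra path_space)"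
  unfolding quenched_def[abs_def]
  by (rule measurable_markov_law) (auto intro: env_transition_stochastic env_transition_measurable)

lemma sets_quenched: "\<omega> \<in> space P \<Longrightarrow> sets (quenched x \<omega>) = sets path_space"
  unfolding quenched_def by (rule prob_space_markov_law) (rule env_transition_stochastic)

lemma prob_space_quenched: "\<omega> \<in> space P \<Longrightarrow> prob_space (quenched x \<omega>)"
  unfolding quenched_def by (rule prob_space_markov_law) (rule env_transition_stochastic)

lemma quenched_emeasure_measurable:
  "A \<in> sets path_space \<Longrightarrow> (\<lambda>\<omega>. emeasure (quenched x \<omega>) A) \<in> borel_measurable P"
  by (rule measurable_compose[OF quenched_measurable measurable_emeasure_subprob_algebra])

lemma annealed_kernel_measurable:
  "(\<lambda>\<omega>. quenched x \<omega> \<bind> (\<lambda>s. return (P \<Otimes>\<^sub>M path_space) (\<omega>, s)))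
     \<in> measurable P (subprob_algebra (P \<Otimes>\<^sub>M path_space))"
proof (rule measurable_bind[OF quenched_measurable])
  have "(\<lambda>z. return (P \<Otimes>\<^sub>M path_space) (fst z, snd z)) \<in>
      measurable (P \<Otimes>\<^sub>M path_space) (subprob_algebra (P \<Otimes>\<^sub>M (path_space :: (nat \<Rightarrow> int ^ 'd) measure)))"
    using return_measurable by simp
  then show "(\<lambda>z. return (P \<Otimes>\<^sub>M path_space) (fst z, snd z)) \<in>
      measurable (P \<Otimes>\<^sub>M path_space) (subprob_algebra (P \<Otimes>\<^sub>M (path_space :: (nat \<Rightarrow> int ^ 'd) measure)))" .
qed

lemma sets_annealed: "sets (annealed P x) = sets (P \<Otimes>\<^sub>M path_space)"
  unfolding annealed_def
  by (rule sets_bind[OF sets_kernel[OF annealed_kernel_measurable]]) (auto simp: not_empty)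

lemma space_annealed: "space (annealed P x) = space P \<times> UNIV"
  using sets_eq_imp_space_eq[OF sets_annealed] by (simp add: space_pair_measure space_path_space)

text \<open>Fubini for the semidirect product: all annealed quantities below are computed as
  environment averages of quenched ones.\<close>

lemma annealed_nn_integral:
  assumes f: "f \<in> borel_measurable (P \<Otimes>\<^sub>M path_space)"
  shows "(\<integral>\<^sup>+ z. f z \<partial>annealed P x) = (\<integral>\<^sup>+ \<omega>. \<integral>\<^sup>+ s. f (\<omega>, s) \<partial>quenched x \<omega> \<partial>P)"
proof -
  have "(\<integral>\<^sup>+ z. f z \<partial>annealed P x) =
      (\<integral>\<^sup>+ \<omega>. \<integral>\<^sup>+ z. f z \<partial>(quenched x \<omega> \<bind> (\<lambda>s. return (P \<Otimes>\<^sub>M path_space) (\<omega>, s))) \<partial>P)"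
    unfolding annealed_def by (rule nn_integral_bind[OF f annealed_kernel_measurable])
  also have "\<dots> = (\<integral>\<^sup>+ \<omega>. \<integral>\<^sup>+ s. f (\<omega>, s) \<partial>quenched x \<omega> \<partial>P)"
  proof (rule nn_integral_cong)
    fix \<omega> assume \<omega>: "\<omega> \<in> space P"
    have k: "(\<lambda>s. (\<omega>, s)) \<in> measurable (quenched x \<omega>) (P \<Otimes>\<^sub>M path_space)"
      unfolding measurable_cong_sets[OF sets_quenched[OF \<omega>] refl] by (rule measurable_Pair1'[OF \<omega>])
    show "(\<integral>\<^sup>+ z. f z \<partial>(quenched x \<omega> \<bind> (\<lambda>s. return (P \<Otimes>\<^sub>M path_space) (\<omega>, s)))) =
        (\<integral>\<^sup>+ s. f (\<omega>, s) \<partial>quenched x \<omega>)"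
      unfolding bind_return_distr'[OF prob_space.not_empty[OF prob_space_quenched[OF \<omega>]] k]
      by (rule nn_integral_distr[OF k]) (simp only: measurable_distr_eq1 f)
  qed
  finally show ?thesis .
qed

lemma annealed_emeasure:
  assumes A: "A \<in> sets path_space"
  shows "emeasure (annealed P x) (space P \<times> A) = (\<integral>\<^sup>+ \<omega>. emeasure (quenched x \<omega>) A \<partial>P)"
proof -
  have m: "space P \<times> A \<in> sets (P \<Otimes>\<^sub>M path_space)"
    using A by (intro pair_measureI) auto
  have "emeasure (annealed P x) (space P \<times> A) = (\<integral>\<^sup>+ z. indicator (space P \<times> A) z \<partial>annealed P x)"
    by (rule nn_integral_indicator[symmetric]) (simp only: sets_annealed m)
  also have "\<dots> = (\<integral>\<^sup>+ \<omega>. \<integral>\<^sup>+ s. indicator (space P \<times> A) (\<omega>, s) \<partial>quenched x \<omega> \<partial>P)"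
    by (rule annealed_nn_integral) (rule borel_measurable_indicator[OF m])
  also have "\<dots> = (\<integral>\<^sup>+ \<omega>. emeasure (quenched x \<omega>) A \<partial>P)"
  proof (rule nn_integral_cong)
    fix \<omega> assume \<omega>: "\<omega> \<in> space P"
    then have "(\<lambda>s. indicator (space P \<times> A) (\<omega>, s) :: ennreal) = indicator A"
      by (auto simp: fun_eq_iff indicator_def)
    then show "(\<integral>\<^sup>+ s. indicator (space P \<times> A) (\<omega>, s) \<partial>quenched x \<omega>) = emeasure (quenched x \<omega>) A"
      using A sets_quenched[OF \<omega>] by simp
  qed
  finally show ?thesis .
qed

lemma prob_space_annealed: "prob_space (annealed P x)"
proof (rule prob_spaceI)
  have "(\<integral>\<^sup>+ \<omega>. emeasure (quenched x \<omega>) UNIV \<partial>P) = (\<integral>\<^sup>+ \<omega>. 1 \<partial>P)"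
  proof (rule nn_integral_cong)
    fix \<omega> assume \<omega>: "\<omega> \<in> space P"
    show "emeasure (quenched x \<omega>) UNIV = 1"
      using prob_space.emeasure_space_1[OF prob_space_quenched[OF \<omega>]]
      unfolding sets_eq_imp_space_eq[OF sets_quenched[OF \<omega>]] space_path_space .
  qed
  then show "emeasure (annealed P x) (space (annealed P x)) = 1"
    unfolding space_annealed
    using sets.top[of path_space]
    by (subst annealed_emeasure) (auto simp: space_path_space emeasure_space_1)
qed

end

section \<open>Kalikow's expectations as sums over time\<close>

lemma le_exit_time_iff: "enat n \<le> exit_time V s \<longleftrightarrow> (\<forall>i<n. s i \<in> V)"
proof -
  have "enat n \<le> exit_time V s \<longleftrightarrow> (\<forall>m. s m \<notin> V \<longrightarrow> n \<le> m)"
    by (simp add: exit_time_def le_INF_iff)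
  then show ?thesis
    using not_less by blast
qed

text \<open>The sums in Kalikow's quotient include the exit time itself, when the walk is already
  outside \<open>V\<close>. That term vanishes for \<open>x\<close> in \<open>V\<close>, since being
  at \<open>x\<close> at time \<open>n\<close> supplies the missing condition at
  \<open>i = n\<close>.\<close>

lemma visit_before_exit_iff:
  assumes "x \<in> V"
  shows "enat n \<le> exit_time V s \<and> s n = x \<longleftrightarrow> s \<in> staying V n x"
  unfolding le_exit_time_iff staying_def using assms by (auto simp: le_less)

context rwre
begin

definition stay_mass :: "(int ^ 'd) set \<Rightarrow> nat \<Rightarrow> int ^ 'd \<Rightarrow> ennreal" where
  "stay_mass V n x = (\<integral>\<^sup>+ \<omega>. emeasure (quenched 0 \<omega>) (staying V n x) \<partial>P)"

text \<open>Both factors depend on the same environment, so the average does not factorize in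
  general. This is the time-\<open>n\<close> part of the numerator of Kalikow's quotient.\<close>

definition step_mass :: "(int ^ 'd) set \<Rightarrow> nat \<Rightarrow> int ^ 'd \<Rightarrow> int ^ 'd \<Rightarrow> ennreal" where
  "step_mass V n x e = (\<integral>\<^sup>+ \<omega>. emeasure (quenched 0 \<omega>) (staying V n x) * ennreal (\<omega> x e) \<partial>P)"

text \<open>Common form of both Kalikow sums: \<open>c\<close> is 1 in the denominator and
  \<open>\<omega> x e\<close> in the numerator.\<close>

lemma annealed_visits:
  fixes c :: "'d env \<Rightarrow> ennreal"
  assumes c: "c \<in> borel_measurable P"
  shows "(\<integral>\<^sup>+ (\<omega>, s). (\<Sum>n. indicator (staying V n x) s * c \<omega>) \<partial>annealed P 0) =
           (\<Sum>n. \<integral>\<^sup>+ \<omega>. emeasure (quenched 0 \<omega>) (staying V n x) * c \<omega> \<partial>P)"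
proof -
  have ind: "indicator (staying V n x) \<in> borel_measurable (path_space :: (nat \<Rightarrow> int ^ 'd) measure)"
    for n by (rule borel_measurable_indicator[OF staying_sets])
  have "(\<lambda>z. \<Sum>n. indicator (staying V n x) (snd z) * c (fst z))
      \<in> borel_measurable (P \<Otimes>\<^sub>M (path_space :: (nat \<Rightarrow> int ^ 'd) measure))"
    by (intro borel_measurable_suminf_order borel_measurable_times_ennreal
        measurable_compose[OF measurable_snd ind] measurable_compose[OF measurable_fst c])
  then have "(\<integral>\<^sup>+ (\<omega>, s). (\<Sum>n. indicator (staying V n x) s * c \<omega>) \<partial>annealed P 0) =
      (\<integral>\<^sup>+ \<omega>. \<integral>\<^sup>+ s. (\<Sum>n. indicator (staying V n x) s * c \<omega>) \<partial>quenched 0 \<omega> \<partial>P)"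
    by (subst annealed_nn_integral) (simp_all only: case_prod_beta' fst_conv snd_conv)
  also have "\<dots> = (\<integral>\<^sup>+ \<omega>. (\<Sum>n. emeasure (quenched 0 \<omega>) (staying V n x) * c \<omega>) \<partial>P)"
  proof (rule nn_integral_cong)
    fix \<omega> assume \<omega>: "\<omega> \<in> space P"
    have ind': "indicator (staying V n x) \<in> borel_measurable (quenched 0 \<omega>)" for n
      using ind unfolding measurable_cong_sets[OF sets_quenched[OF \<omega>] refl] .
    have st: "staying V n x \<in> sets (quenched 0 \<omega>)" for n
      unfolding sets_quenched[OF \<omega>] by (rule staying_sets)
    have "(\<integral>\<^sup>+ s. (\<Sum>n. indicator (staying V n x) s * c \<omega>) \<partial>quenched 0 \<omega>) =
        (\<Sum>n. \<integral>\<^sup>+ s. indicator (staying V n x) s * c \<omega> \<partial>quenched 0 \<omega>)"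
      by (rule nn_integral_suminf) (intro borel_measurable_times_ennreal ind' borel_measurable_const)
    also have "\<dots> = (\<Sum>n. emeasure (quenched 0 \<omega>) (staying V n x) * c \<omega>)"
      by (simp only: nn_integral_multc[OF ind'] nn_integral_indicator[OF st])
    finally show "(\<integral>\<^sup>+ s. (\<Sum>n. indicator (staying V n x) s * c \<omega>) \<partial>quenched 0 \<omega>) =
        (\<Sum>n. emeasure (quenched 0 \<omega>) (staying V n x) * c \<omega>)" .
  qed
  also have "\<dots> = (\<Sum>n. \<integral>\<^sup>+ \<omega>. emeasure (quenched 0 \<omega>) (staying V n x) * c \<omega> \<partial>P)"
    by (rule nn_integral_suminf)
       (intro borel_measurable_times_ennreal c quenched_emeasure_measurable staying_sets)
  finally show ?thesis .
qed

lemma kalikow_den_eq: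
  assumes "x \<in> V"
  shows "kalikow_den P V x = (\<Sum>n. stay_mass V n x)"
proof -
  have "(if enat n \<le> exit_time V s then indicator {x} (s n) else 0 :: ennreal) =
      indicator (staying V n x) s * 1" for n s
    using visit_before_exit_iff[OF assms, of n s] by (auto simp: indicator_def)
  then show ?thesis
    unfolding kalikow_den_def stay_mass_def
    using annealed_visits[of "\<lambda>_. 1" V x] by (simp only: borel_measurable_const mult_1_right)
qed

lemma kalikow_num_eq:
  assumes "x \<in> V" "e \<in> unit_steps"
  shows "kalikow_num P V x e = (\<Sum>n. step_mass V n x e)"
proof -
  have "(if enat n \<le> exit_time V s then indicator {x} (s n) * ennreal (\<omega> x e) else 0 :: ennreal) =
      indicator (staying V n x) s * ennreal (\<omega> x e)" for n s \<omega>
    using visit_before_exit_iff[OF assms(1), of n s] by (auto simp: indicator_def)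
  then show ?thesis
    unfolding kalikow_num_def step_mass_def
    using annealed_visits[of "\<lambda>\<omega>. ennreal (\<omega> x e)" V x] env_measurable[OF assms(2), of x]
    by (simp only: measurable_compose[OF _ measurable_ennreal])
qed

lemma stay_mass_eq_sum_step: "stay_mass V n x = (\<Sum>e\<in>unit_steps. step_mass V n x e)"
proof -
  have "(\<Sum>e\<in>unit_steps. step_mass V n x e) =
      (\<integral>\<^sup>+ \<omega>. (\<Sum>e\<in>unit_steps. emeasure (quenched 0 \<omega>) (staying V n x) * ennreal (\<omega> x e)) \<partial>P)"
    unfolding step_mass_def
    by (rule nn_integral_sum[symmetric])
       (intro borel_measurable_times_ennreal quenched_emeasure_measurable staying_sets
          measurable_compose[OF env_measurable measurable_ennreal])
  also have "\<dots> = stay_mass V n x"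
    unfolding stay_mass_def
  proof (rule nn_integral_cong)
    fix \<omega> assume \<omega>: "\<omega> \<in> space P"
    have "(\<Sum>e\<in>unit_steps. ennreal (\<omega> x e)) = 1"
      using env_sum[OF \<omega>] env_nonneg[OF \<omega>] by (simp add: sum_ennreal)
    then show "(\<Sum>e\<in>unit_steps. emeasure (quenched 0 \<omega>) (staying V n x) * ennreal (\<omega> x e)) =
        emeasure (quenched 0 \<omega>) (staying V n x)"
      by (simp add: sum_distrib_left[symmetric])
  qed
  finally show ?thesis ..
qed

text \<open>Uniform ellipticity survives averaging because its lower bound is the same in every
  environment.\<close>

lemma step_mass_ge: "e \<in> unit_steps \<Longrightarrow> ennreal (2 * \<kappa>) * stay_mass V n x \<le> step_mass V n x e"
  unfolding stay_mass_def step_mass_def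
  by (subst nn_integral_cmult[symmetric])
     (auto intro!: quenched_emeasure_measurable staying_sets nn_integral_mono mult_left_mono
        ennreal_leI env_ge simp: mult.commute[of "ennreal (2 * \<kappa>)"])

lemma stay_mass_le_1: "stay_mass V n x \<le> 1"
proof -
  have "stay_mass V n x \<le> (\<integral>\<^sup>+ \<omega>. 1 \<partial>P)"
    unfolding stay_mass_def
    by (rule nn_integral_mono) (rule subprob_space.subprob_emeasure_le_1[OF prob_space_imp_subprob_space[OF prob_space_quenched]])
  then show ?thesis by (simp add: emeasure_space_1)
qed

lemma stay_mass_0: "stay_mass V 0 x = (if x = 0 \<and> x \<in> V then 1 else 0)"
proof -
  have "emeasure (quenched 0 \<omega>) (staying V 0 x) = (if x = 0 \<and> x \<in> V then 1 else 0)"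
    if \<omega>: "\<omega> \<in> space P" for \<omega>
  proof (cases "x \<in> V")
    case True
    then have "staying V 0 x = {s. \<forall>i\<le>0. s i = (\<lambda>_. x) i}"
      by (auto simp: staying_def)
    then show ?thesis
      unfolding quenched_def
      using True by (simp only: emeasure_markov_law[OF env_transition_stochastic[OF \<omega>]]) simp
  next
    case False
    then have "staying V 0 x = {}"
      by (auto simp: staying_def)
    with False show ?thesis by simp
  qed
  then have "stay_mass V 0 x = (\<integral>\<^sup>+ \<omega>. (if x = 0 \<and> x \<in> V then 1 else 0) \<partial>P)"
    unfolding stay_mass_def by (intro nn_integral_cong) auto
  then show ?thesis
    by (simp add: emeasure_space_1)
qed

lemma annealed_staying: "emeasure (annealed P 0) (space P \<times> staying V n x) = stay_mass V n x"
  unfolding stay_mass_def by (rule annealed_emeasure[OF staying_sets])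

lemma annealed_staying_step:
  assumes V: "finite V"
  shows "emeasure (annealed P 0) (space P \<times> {s \<in> staying V n x. s (Suc n) = y}) =
           (if y - x \<in> unit_steps then step_mass V n x (y - x) else 0)"
proof -
  have "emeasure (annealed P 0) (space P \<times> {s \<in> staying V n x. s (Suc n) = y}) =
      (\<integral>\<^sup>+ \<omega>. emeasure (quenched 0 \<omega>) (staying V n x) * ennreal (env_transition \<omega> x y) \<partial>P)"
    unfolding annealed_emeasure[OF staying_step_sets] quenched_def
    by (intro nn_integral_cong emeasure_markov_law_staying_step env_transition_stochastic V)
  then show ?thesis
    by (simp add: env_transition_def step_mass_def)
qed

text \<open>Forward equation of the walk killed outside \<open>V\<close>, obtained by splitting
  according to the position at time \<open>n\<close>.\<close>

lemma stay_mass_Suc: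
  assumes V: "finite V" and y: "y \<in> V"
  shows "stay_mass V (Suc n) y =
           (\<Sum>x\<in>V. \<Sum>e\<in>unit_steps. if x + e = y then step_mass V n x e else 0)"
proof -
  let ?A = "\<lambda>x. space P \<times> {s \<in> staying V n x. s (Suc n) = y}"
  have "stay_mass V (Suc n) y = emeasure (annealed P 0) (\<Union>x\<in>V. ?A x)"
    unfolding annealed_staying[symmetric]
    by (rule arg_cong[where f="emeasure _"]) (use y in \<open>auto simp: staying_def le_Suc_eq\<close>)
  also have "\<dots> = (\<Sum>x\<in>V. emeasure (annealed P 0) (?A x))"
  proof (rule sum_emeasure[symmetric])
    show "?A ` V \<subseteq> sets (annealed P 0)"
      unfolding sets_annealed by (intro image_subsetI pair_measureI sets.top staying_step_sets)
    show "disjoint_family_on ?A V"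
      by (auto simp: disjoint_family_on_def staying_def)
  qed (rule V)
  also have "\<dots> = (\<Sum>x\<in>V. \<Sum>e\<in>unit_steps. if x + e = y then step_mass V n x e else 0)"
  proof (rule sum.cong[OF refl])
    fix x
    have "(\<Sum>e\<in>unit_steps. if x + e = y then step_mass V n x e else 0) =
        (\<Sum>e\<in>unit_steps. if y - x = e then step_mass V n x e else 0)"
      by (intro sum.cong refl) (simp add: algebra_simps eq_commute)
    then show "emeasure (annealed P 0) (?A x) =
        (\<Sum>e\<in>unit_steps. if x + e = y then step_mass V n x e else 0)"
      by (simp only: annealed_staying_step[OF V] sum.delta' finite_unit_steps)
  qed
  finally show ?thesis .
qed

end

section \<open>Dynkin's formula and the Green function of a finite domain\<close>

locale rwre_domain = rwre P \<kappa> for P :: "'d::finite env measure" and \<kappa> :: real +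
  fixes V :: "(int ^ 'd) set"
  assumes finite_V: "finite V" and zero_in_V: "0 \<in> V"
begin

text \<open>Real versions of the masses, since Dynkin's formula involves differences. Nothing is
  lost for unit steps, as the masses are at most 1.\<close>

definition U :: "nat \<Rightarrow> int ^ 'd \<Rightarrow> real" where
  "U n x = enn2real (stay_mass V n x)"

definition W :: "nat \<Rightarrow> int ^ 'd \<Rightarrow> int ^ 'd \<Rightarrow> real" where
  "W n x e = enn2real (step_mass V n x e)"

lemma U_nonneg: "0 \<le> U n x" and W_nonneg: "0 \<le> W n x e"
  by (simp_all add: U_def W_def)

lemma ennreal_U: "ennreal (U n x) = stay_mass V n x"
  unfolding U_def using stay_mass_le_1[of V n x] by (intro ennreal_enn2real) (auto simp: top.not_eq_extremum intro: le_less_trans)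

lemma step_mass_le: "e \<in> unit_steps \<Longrightarrow> step_mass V n x e \<le> stay_mass V n x"
  unfolding stay_mass_eq_sum_step by (rule member_le_sum) (auto simp: finite_unit_steps)

lemma ennreal_W: "e \<in> unit_steps \<Longrightarrow> ennreal (W n x e) = step_mass V n x e"
  unfolding W_def using order_trans[OF step_mass_le[of e n x] stay_mass_le_1[of V n x]]
  by (intro ennreal_enn2real) (auto simp: top.not_eq_extremum intro: le_less_trans)

lemma sum_W: "(\<Sum>e\<in>unit_steps. W n x e) = U n x"
proof -
  have "ennreal (\<Sum>e\<in>unit_steps. W n x e) = (\<Sum>e\<in>unit_steps. step_mass V n x e)"
    by (simp add: sum_ennreal[symmetric] W_nonneg ennreal_W)
  then have "ennreal (\<Sum>e\<in>unit_steps. W n x e) = ennreal (U n x)"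
    by (simp only: ennreal_U stay_mass_eq_sum_step)
  then show ?thesis
    by (simp add: U_nonneg W_nonneg sum_nonneg)
qed

lemma W_ge: "e \<in> unit_steps \<Longrightarrow> 2 * \<kappa> * U n x \<le> W n x e"
  using step_mass_ge[of e V n x] kappa_pos
  by (simp add: ennreal_U[symmetric] ennreal_W[symmetric] ennreal_mult[symmetric] U_nonneg W_nonneg)

lemma U_0: "x \<in> V \<Longrightarrow> U 0 x = (if x = 0 then 1 else 0)"
  by (simp add: U_def stay_mass_0)

lemma U_Suc:
  assumes "y \<in> V"
  shows "U (Suc n) y = (\<Sum>x\<in>V. \<Sum>e\<in>unit_steps. if x + e = y then W n x e else 0)" (is "_ = ?r")
proof -
  have "ennreal ?r = (\<Sum>x\<in>V. ennreal (\<Sum>e\<in>unit_steps. if x + e = y then W n x e else 0))"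
    by (rule sum_ennreal[symmetric]) (auto intro!: sum_nonneg simp: W_nonneg)
  also have "\<dots> = (\<Sum>x\<in>V. \<Sum>e\<in>unit_steps. ennreal (if x + e = y then W n x e else 0))"
    by (intro sum.cong refl sum_ennreal[symmetric]) (auto simp: W_nonneg)
  also have "\<dots> = stay_mass V (Suc n) y"
    unfolding stay_mass_Suc[OF finite_V assms] by (intro sum.cong refl) (auto simp: ennreal_W)
  finally have "ennreal (U (Suc n) y) = ennreal ?r"
    by (simp only: ennreal_U)
  moreover have "0 \<le> ?r"
    by (auto intro!: sum_nonneg simp: W_nonneg)
  ultimately show ?thesis
    by (simp only: ennreal_inj U_nonneg)
qed

text \<open>The annealed expectation of \<open>F\<close> at the exit point, on the event that the
  walk leaves \<open>V\<close> at time \<open>Suc n\<close>.\<close>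

definition exit_sum :: "nat \<Rightarrow> (int ^ 'd \<Rightarrow> real) \<Rightarrow> real" where
  "exit_sum n F = (\<Sum>x\<in>V. \<Sum>e\<in>unit_steps. if x + e \<in> V then 0 else W n x e * F (x + e))"

text \<open>At each time the surviving mass takes one step: what leaves \<open>V\<close> enters
  \<open>exit_sum\<close>, what remains enters \<open>U\<close> at the next time. The annealed walk
  is not Markovian in general, but the argument rests only on conservation of mass
  (\<open>sum_W\<close>) and the forward equation (\<open>U_Suc\<close>).\<close>

lemma dynkin:
  "(\<Sum>n<N. exit_sum n F) + (\<Sum>x\<in>V. U N x * F x) =
     F 0 + (\<Sum>n<N. \<Sum>x\<in>V. \<Sum>e\<in>unit_steps. W n x e * (F (x + e) - F x))"
proof (induction N)
  case 0
  have "(\<Sum>x\<in>V. U 0 x * F x) = (\<Sum>x\<in>V. if x = 0 then F x else 0)"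
    by (intro sum.cong) (auto simp: U_0)
  then show ?case
    by (simp add: finite_V zero_in_V)
next
  case (Suc N)
  have "(\<Sum>y\<in>V. U (Suc N) y * F y) =
      (\<Sum>y\<in>V. \<Sum>x\<in>V. \<Sum>e\<in>unit_steps. if x + e = y then W N x e * F y else 0)"
    by (intro sum.cong refl) (auto simp: U_Suc sum_distrib_right intro!: sum.cong)
  also have "\<dots> = (\<Sum>x\<in>V. \<Sum>y\<in>V. \<Sum>e\<in>unit_steps. if x + e = y then W N x e * F y else 0)"
    by (rule sum.swap)
  also have "\<dots> = (\<Sum>x\<in>V. \<Sum>e\<in>unit_steps. \<Sum>y\<in>V. if x + e = y then W N x e * F y else 0)"
    by (intro sum.cong refl sum.swap)
  also have "\<dots> = (\<Sum>x\<in>V. \<Sum>e\<in>unit_steps. if x + e \<in> V then W N x e * F (x + e) else 0)"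
    by (intro sum.cong refl) (simp add: finite_V)
  finally have "exit_sum N F + (\<Sum>y\<in>V. U (Suc N) y * F y) =
      (\<Sum>x\<in>V. \<Sum>e\<in>unit_steps. W N x e * F (x + e))"
    unfolding exit_sum_def by (auto simp: sum.distrib[symmetric] intro!: sum.cong)
  also have "\<dots> = (\<Sum>x\<in>V. \<Sum>e\<in>unit_steps. W N x e * (F (x + e) - F x)) + (\<Sum>x\<in>V. U N x * F x)"
    unfolding sum_W[symmetric] sum_distrib_right sum.distrib[symmetric]
    by (simp add: algebra_simps)
  finally show ?case
    using Suc by simp
qed

lemma exit_sum_mono:
  "(\<And>x e. x \<in> V \<Longrightarrow> e \<in> unit_steps \<Longrightarrow> F (x + e) \<le> G (x + e)) \<Longrightarrow> exit_sum n F \<le> exit_sum n G"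
  unfolding exit_sum_def by (auto intro!: sum_mono mult_left_mono simp: W_nonneg)

lemma exit_sum_nonneg: "(\<And>x. 0 \<le> F x) \<Longrightarrow> 0 \<le> exit_sum n F"
  unfolding exit_sum_def by (auto intro!: sum_nonneg mult_nonneg_nonneg simp: W_nonneg)

text \<open>Uniform ellipticity makes \<open>exp (b * x $ i)\<close> strictly subharmonic once \<open>exp b\<close> is large,
  which bounds the expected time spent in \<open>V\<close>.\<close>

lemma summable_U:
  assumes "x \<in> V"
  shows "summable (\<lambda>n. U n x)"
proof -
  obtain k :: 'd where "k \<in> UNIV" by blast
  \<comment> \<open>With \<open>exp b = 1 / \<kappa>\<close> the step \<open>axis k 1\<close>, whose
    share of the mass is at least \<open>2 * \<kappa>\<close>, alone brings in twice
    \<open>F y\<close>. The mean increment is therefore at least \<open>F y\<close>, hence at least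
    \<open>m\<close>.\<close>
  define b where "b = ln (1 / \<kappa>)"
  have exp_b: "exp b = 1 / \<kappa>"
    using kappa_pos by (simp add: b_def)
  define F where "F y = exp (b * real_of_int (y $ k))" for y :: "int ^ 'd"
  define m where "m = Min (F ` V)"
  have m_le: "m \<le> F y" if "y \<in> V" for y
    using that finite_V by (auto simp: m_def)
  have "m \<in> F ` V"
    unfolding m_def using finite_V zero_in_V by (intro Min_in) auto
  then have m_pos: "0 < m"
    by (auto simp: F_def)
  \<comment> \<open>A bound for \<open>F\<close> on \<open>V\<close> and on all points one step
    away, which include the exit points.\<close>
  define C where "C = Max (F ` (V \<union> (\<lambda>(x, e). x + e) ` (V \<times> unit_steps)))"
  have C_ge: "F y \<le> C" if "y \<in> V \<union> (\<lambda>(x, e). x + e) ` (V \<times> unit_steps)" for y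
    unfolding C_def using that finite_V finite_unit_steps by (intro Max_ge) auto
  have e0: "axis k 1 \<in> (unit_steps :: (int ^ 'd) set)"
    by (simp add: unit_steps_iff axis_def if_distrib[of "\<lambda>a. a\<^sup>2"] cong: if_cong)
  have drift: "m * U n y \<le> (\<Sum>e\<in>unit_steps. W n y e * (F (y + e) - F y))" if y: "y \<in> V" for n y
  proof -
    have "U n y \<le> 2 * \<kappa> * U n y * exp b - U n y"
      using kappa_pos by (simp add: exp_b)
    also have "\<dots> \<le> W n y (axis k 1) * exp b - U n y"
      using W_ge[OF e0, of n y] by (simp add: mult_right_mono)
    also have "\<dots> \<le> (\<Sum>e\<in>unit_steps. W n y e * exp (b * real_of_int (e $ k))) - U n y"
      using member_le_sum[OF e0, of "\<lambda>e. W n y e * exp (b * real_of_int (e $ k))"] finite_unit_steps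
      by (simp add: W_nonneg)
    finally have "m * U n y \<le> F y * ((\<Sum>e\<in>unit_steps. W n y e * exp (b * real_of_int (e $ k))) - U n y)"
      using m_le[OF y] m_pos by (intro mult_mono) (auto simp: U_nonneg F_def)
    also have "\<dots> = (\<Sum>e\<in>unit_steps. W n y e * (F (y + e) - F y))"
      by (simp add: F_def sum_W[symmetric] sum_subtractf[symmetric] sum_distrib_left algebra_simps exp_add)
    finally show ?thesis .
  qed
  have "(\<Sum>n<N. U n x) \<le> C / m" for N
  proof -
    have "m * (\<Sum>n<N. U n x) \<le> (\<Sum>n<N. \<Sum>y\<in>V. m * U n y)"
      unfolding sum_distrib_left using assms m_pos finite_V
      by (intro sum_mono member_le_sum) (auto simp: U_nonneg)
    also have "\<dots> \<le> (\<Sum>n<N. \<Sum>y\<in>V. \<Sum>e\<in>unit_steps. W n y e * (F (y + e) - F y))"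
      by (intro sum_mono drift)
    also have "\<dots> \<le> (\<Sum>n<N. exit_sum n F) + (\<Sum>y\<in>V. U N y * F y)"
      unfolding dynkin by (simp add: F_def)
    also have "\<dots> \<le> (\<Sum>n<N. exit_sum n (\<lambda>_. C)) + (\<Sum>y\<in>V. U N y * C)"
      by (intro add_mono sum_mono exit_sum_mono mult_left_mono C_ge) (auto simp: U_nonneg)
    \<comment> \<open>A constant has no increments: exit mass and surviving mass add up to
      one.\<close>
    also have "\<dots> = C"
      using dynkin[where N=N and F="\<lambda>_. C"] by simp
    finally show ?thesis
      using m_pos by (simp add: field_simps)
  qed
  then show ?thesis
    by (intro summableI_nonneg_bounded[of _ "C / m"]) (auto simp: U_nonneg)
qed

lemma summable_W:
  assumes "x \<in> V" "e \<in> unit_steps"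
  shows "summable (\<lambda>n. W n x e)"
proof (rule summable_comparison_test'[OF summable_U[OF assms(1)]])
  fix n
  have "W n x e \<le> U n x"
    unfolding sum_W[symmetric] by (rule member_le_sum) (use assms in \<open>auto simp: finite_unit_steps W_nonneg\<close>)
  then show "norm (W n x e) \<le> U n x"
    by (simp add: W_nonneg)
qed

text \<open>The annealed Green function of \<open>V\<close> and the expected number of crossings of a bond; their quotient
  is the transition probability of Kalikow's chain.\<close>

definition green :: "int ^ 'd \<Rightarrow> real" where
  "green x = (\<Sum>n. U n x)"

definition flow :: "int ^ 'd \<Rightarrow> int ^ 'd \<Rightarrow> real" where
  "flow x e = (\<Sum>n. W n x e)"

lemma flow_nonneg: "x \<in> V \<Longrightarrow> e \<in> unit_steps \<Longrightarrow> 0 \<le> flow x e"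
  unfolding flow_def by (intro suminf_nonneg summable_W W_nonneg)

lemma sum_flow:
  assumes "x \<in> V" shows "(\<Sum>e\<in>unit_steps. flow x e) = green x"
  unfolding flow_def green_def
  by (subst suminf_sum[symmetric]) (use assms in \<open>auto simp: summable_W sum_W\<close>)

lemma kalikow_den_green: "x \<in> V \<Longrightarrow> kalikow_den P V x = ennreal (green x)"
  unfolding kalikow_den_eq green_def ennreal_U[symmetric]
  by (intro suminf_ennreal2 summable_U U_nonneg)

lemma kalikow_num_flow: "x \<in> V \<Longrightarrow> e \<in> unit_steps \<Longrightarrow> kalikow_num P V x e = ennreal (flow x e)"
  unfolding flow_def kalikow_num_eq
  by (simp add: ennreal_W[symmetric] suminf_ennreal2 summable_W W_nonneg)

text \<open>A step ending in \<open>V\<close> is a visit one time unit later, and ellipticity bounds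
  its mass from below.\<close>

lemma green_step:
  assumes x: "x \<in> V" and e: "e \<in> unit_steps" and y: "x + e \<in> V"
  shows "2 * \<kappa> * green x \<le> green (x + e)"
proof -
  have "W n x e \<le> U (Suc n) (x + e)" for n
  proof -
    have "W n x e \<le> (\<Sum>e'\<in>unit_steps. if x + e' = x + e then W n x e' else 0)"
      using e by (simp add: finite_unit_steps)
    also have "\<dots> \<le> U (Suc n) (x + e)"
      unfolding U_Suc[OF y]
      by (rule member_le_sum[OF x]) (auto simp: finite_V W_nonneg intro!: sum_nonneg)
    finally show ?thesis .
  qed
  then have *: "2 * \<kappa> * U n x \<le> U (Suc n) (x + e)" for n
    using W_ge[OF e, of n x] order_trans by blast
  have "2 * \<kappa> * green x \<le> (\<Sum>n. U (Suc n) (x + e))"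
    unfolding green_def suminf_mult[OF summable_U[OF x], symmetric]
    by (intro suminf_le * summable_mult summable_U x summable_Suc_iff[THEN iffD2] y)
  also have "\<dots> \<le> green (x + e)"
    unfolding green_def using suminf_split_head[OF summable_U[OF y]] U_nonneg[of 0 "x + e"] by simp
  finally show ?thesis .
qed

text \<open>Keeps the denominator of Kalikow's quotient away from zero. At the origin the visit at
  time 0 counts 1, and \<open>green_step\<close> carries positivity along a path in the connected
  set.\<close>

lemma green_pos:
  assumes conn: "lattice_connected V" and x: "x \<in> V"
  shows "0 < green x"
proof -
  have "(0, x) \<in> {(a, b). a \<in> V \<and> b \<in> V \<and> b - a \<in> unit_steps}\<^sup>*"
    using conn zero_in_V x unfolding lattice_connected_def by blast
  then show ?thesis
  proof (induction rule: rtrancl_induct)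
    case base
    have "U 0 0 \<le> green 0"
      unfolding green_def using sum_le_suminf[OF summable_U[OF zero_in_V], of "{0}"] by (simp add: U_nonneg)
    then show ?case
      by (simp add: U_0 zero_in_V)
  next
    case (step y z)
    then have "2 * \<kappa> * green y \<le> green (y + (z - y))"
      by (intro green_step) auto
    moreover have "0 < 2 * \<kappa> * green y"
      using step kappa_pos by simp
    ultimately show ?case by simp
  qed
qed

text \<open>Superharmonicity is assumed for the flow summed over all times, not at each single time.
  A second horizon \<open>M\<close> is therefore sent to infinity in Dynkin's formula while
  \<open>N\<close> stays fixed, and the nonnegative terms beyond \<open>N\<close> are
  dropped.\<close>

lemma exit_sum_le:
  assumes F: "\<And>x. 0 \<le> F x"
    and super: "\<And>x. x \<in> V \<Longrightarrow> (\<Sum>e\<in>unit_steps. flow x e * (F (x + e) - F x)) \<le> 0"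
  shows "(\<Sum>n<N. exit_sum n F) \<le> F 0"
proof -
  let ?D = "\<lambda>M. F 0 + (\<Sum>x\<in>V. \<Sum>e\<in>unit_steps. (\<Sum>n<M. W n x e) * (F (x + e) - F x))"
  have D: "?D M = (\<Sum>n<M. exit_sum n F) + (\<Sum>x\<in>V. U M x * F x)" for M
  proof -
    have "(\<Sum>n<M. \<Sum>x\<in>V. \<Sum>e\<in>unit_steps. W n x e * (F (x + e) - F x)) =
        (\<Sum>x\<in>V. \<Sum>n<M. \<Sum>e\<in>unit_steps. W n x e * (F (x + e) - F x))"
      by (rule sum.swap)
    also have "\<dots> = (\<Sum>x\<in>V. \<Sum>e\<in>unit_steps. \<Sum>n<M. W n x e * (F (x + e) - F x))"
      by (intro sum.cong refl sum.swap)
    finally show ?thesis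
      unfolding dynkin by (simp add: sum_distrib_right)
  qed
  have "?D \<longlonglongrightarrow> F 0 + (\<Sum>x\<in>V. \<Sum>e\<in>unit_steps. flow x e * (F (x + e) - F x))"
    unfolding flow_def by (intro tendsto_intros tendsto_sum summable_LIMSEQ summable_W)
  moreover have "\<exists>M0. \<forall>M\<ge>M0. (\<Sum>n<N. exit_sum n F) \<le> ?D M"
  proof (intro exI[of _ N] allI impI)
    fix M assume "N \<le> M"
    then have "(\<Sum>n<N. exit_sum n F) \<le> (\<Sum>n<M. exit_sum n F)"
      by (intro sum_mono2) (auto simp: exit_sum_nonneg F)
    also have "\<dots> \<le> ?D M"
      unfolding D by (simp add: sum_nonneg U_nonneg F)
    finally show "(\<Sum>n<N. exit_sum n F) \<le> ?D M" .
  qed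
  ultimately have "(\<Sum>n<N. exit_sum n F) \<le> F 0 + (\<Sum>x\<in>V. \<Sum>e\<in>unit_steps. flow x e * (F (x + e) - F x))"
    by (rule LIMSEQ_le_const)
  also have "\<dots> \<le> F 0"
    using sum_nonpos[of V "\<lambda>x. \<Sum>e\<in>unit_steps. flow x e * (F (x + e) - F x)"] super by simp
  finally show ?thesis .
qed

end

text \<open>For negative \<open>t\<close>, compare after multiplying by \<open>1 - t\<close>: the
  left side becomes at most 1, the right side \<open>1 - t ^ 3\<close>, which is at least 1.\<close>

lemma exp_le_quadratic:
  fixes t :: real
  assumes "\<bar>t\<bar> \<le> 1"
  shows "exp t \<le> 1 + t + t\<^sup>2"
proof (cases "0 \<le> t")
  case True
  then show ?thesis using assms by (intro exp_bound) auto
next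
  case False
  have "(1 - t) * exp t \<le> exp (- t) * exp t"
    using exp_ge_add_one_self[of "- t"] by (intro mult_right_mono) auto
  then have "(1 - t) * exp t \<le> 1"
    by (simp add: exp_minus)
  also have "1 \<le> (1 - t) * (1 + t + t\<^sup>2)"
    using False mult_nonneg_nonneg[of "- t" "t\<^sup>2"] by (simp add: algebra_simps power2_eq_square)
  finally show ?thesis
    using False by (simp add: mult_le_cancel_left)
qed

section \<open>From superharmonic functions to exit probabilities\<close>

context rwre
begin

lemma annealed_AE_start: "AE z in annealed P 0. snd z 0 = 0"
proof -
  interpret A: prob_space "annealed P 0" by (rule prob_space_annealed)
  have "emeasure (annealed P 0) (space P \<times> staying UNIV 0 0) = 1"
    by (simp add: annealed_staying stay_mass_0)
  then have "A.prob (space P \<times> staying UNIV 0 0) = 1"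
    by (simp add: A.emeasure_eq_measure)
  then have "AE z in annealed P 0. z \<in> space P \<times> staying UNIV 0 0"
    by (rule A.AE_prob_1)
  then show ?thesis
    by (rule AE_mp) (auto simp: staying_def)
qed

text \<open>Each jump other than a unit step has mass zero by the one-step formula, and there are
  only countably many triples of a time and two sites. The formula concerns walks still in the
  finite set \<open>V\<close>, hence the restriction to \<open>staying\<close>.\<close>

lemma annealed_AE_steps:
  assumes V: "finite V"
  shows "AE z in annealed P 0. \<forall>n x. snd z \<in> staying V n x \<longrightarrow> snd z (Suc n) - x \<in> unit_steps"
proof -
  have "AE z in annealed P 0. y - x \<notin> unit_steps \<longrightarrow> \<not> (snd z \<in> staying V n x \<and> snd z (Suc n) = y)" for n x y
  proof (cases "y - x \<in> unit_steps")
    case False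
    let ?N = "space P \<times> {s \<in> staying V n x. s (Suc n) = y}"
    have "?N \<in> null_sets (annealed P 0)"
      unfolding null_sets_def using annealed_staying_step[OF V, of n x y] False
      by (auto simp: sets_annealed intro!: pair_measureI staying_step_sets)
    from AE_not_in[OF this] AE_space show ?thesis
      by eventually_elim (auto simp: space_annealed)
  qed simp
  then have "AE z in annealed P 0. \<forall>n x y. y - x \<notin> unit_steps \<longrightarrow>
      \<not> (snd z \<in> staying V n x \<and> snd z (Suc n) = y)"
    by (simp only: AE_all_countable) blast
  then show ?thesis
    by eventually_elim blast
qed

end

context rwre_domain
begin

text \<open>Markov's inequality at the exit point. The set \<open>Z\<close> enters only through an
  almost sure inclusion in a measurable set, so it may be arbitrary.\<close>

lemma exit_prob_le:
  assumes Z: "\<And>s n x e. s \<in> Z \<Longrightarrow> s 0 = 0 \<Longrightarrow> x \<in> V \<Longrightarrow> e \<in> unit_steps \<Longrightarrow> s \<in> staying V n x \<Longrightarrow>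
        s (Suc n) = x + e \<Longrightarrow> x + e \<notin> V \<Longrightarrow> 1 \<le> F (x + e)"
    and F: "\<And>x. 0 \<le> F x"
    and super: "\<And>x. x \<in> V \<Longrightarrow> (\<Sum>e\<in>unit_steps. flow x e * (F (x + e) - F x)) \<le> 0"
  shows "measure (annealed P 0) (space P \<times> Z) \<le> F 0"
proof -
  interpret A: prob_space "annealed P 0" by (rule prob_space_annealed)
  let ?m = "measure (annealed P 0)"
  define I where "I = {(x, e). x \<in> V \<and> e \<in> unit_steps \<and> x + e \<notin> V \<and> 1 \<le> F (x + e)}"
  have I_sub: "I \<subseteq> V \<times> unit_steps"
    by (auto simp: I_def)
  then have I: "finite I"
    using finite_V finite_unit_steps by (auto intro: finite_subset)
  define A where "A n x = space P \<times> staying V n x" for n x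
  define B where "B n = (\<lambda>(x, e). space P \<times> {s \<in> staying V n x. s (Suc n) = x + e})" for n
  have A_sets: "A n x \<in> A.events" for n x
    unfolding A_def sets_annealed by (intro pair_measureI sets.top staying_sets)
  have B_sets: "B n i \<in> A.events" for n i
    unfolding B_def sets_annealed by (cases i) (auto intro!: pair_measureI staying_step_sets)
  have mA: "?m (A n x) = U n x" for n x
    by (simp add: A_def measure_def annealed_staying U_def)
  have mB: "?m (B n (x, e)) = W n x e" if "e \<in> unit_steps" for n x e
    using that by (simp add: B_def measure_def annealed_staying_step[OF finite_V] W_def)
  have bound: "?m (space P \<times> Z) \<le> F 0 + (\<Sum>x\<in>V. U N x)" for N
  proof -
    \<comment> \<open>Either the walk is still in \<open>V\<close> at time \<open>N\<close>, or it
      has left by then through a bond in \<open>I\<close>.\<close>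
    let ?C = "(\<Union>x\<in>V. A N x) \<union> (\<Union>n<N. \<Union>i\<in>I. B n i)"
    have C_sets: "?C \<in> A.events"
      using finite_V I by (intro sets.Un sets.finite_UN A_sets B_sets) auto
    have "AE z in annealed P 0. z \<in> space P \<times> Z \<longrightarrow> z \<in> ?C"
      using annealed_AE_start annealed_AE_steps[OF finite_V]
    proof eventually_elim
      fix z :: "'d env \<times> (nat \<Rightarrow> int ^ 'd)"
      assume start: "snd z 0 = 0"
        and steps: "\<forall>n x. snd z \<in> staying V n x \<longrightarrow> snd z (Suc n) - x \<in> unit_steps"
      define s where "s = snd z"
      show "z \<in> space P \<times> Z \<longrightarrow> z \<in> ?C"
      proof
        assume "z \<in> space P \<times> Z"
        then have z: "fst z \<in> space P" "s \<in> Z"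
          by (auto simp: s_def)
        show "z \<in> ?C"
        proof (cases "\<forall>i\<le>N. s i \<in> V")
          case True
          then have "s \<in> staying V N (s N)" "s N \<in> V"
            by (auto simp: staying_def)
          with z have "z \<in> A N (s N)"
            by (cases z) (auto simp: A_def s_def)
          with \<open>s N \<in> V\<close> show ?thesis by blast
        next
          case False
          define t where "t = (LEAST i. s i \<notin> V)"
          from False obtain i where i: "i \<le> N" "s i \<notin> V" by auto
          have t: "s t \<notin> V"
            unfolding t_def by (rule LeastI[of "\<lambda>i. s i \<notin> V" i]) (rule i)
          have tN: "t \<le> N"
            using Least_le[of "\<lambda>i. s i \<notin> V", OF i(2)] i(1) by (simp add: t_def)
          have before: "s j \<in> V" if "j < t" for j
            using not_less_Least[of j "\<lambda>i. s i \<notin> V"] that by (auto simp: t_def)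
          have "t \<noteq> 0"
            using t start zero_in_V by (auto simp: s_def intro: gr0I)
          then obtain n where n: "t = Suc n" by (cases t) auto
          have st: "s \<in> staying V n (s n)" "s n \<in> V"
            using before by (auto simp: staying_def n less_Suc_eq_le)
          define e where "e = s (Suc n) - s n"
          have e: "e \<in> unit_steps" "s (Suc n) = s n + e"
            using steps st(1) by (auto simp: e_def s_def)
          have out: "s n + e \<notin> V"
            using t n e by simp
          have "1 \<le> F (s n + e)"
            using start st by (intro Z[OF z(2) _ st(2) e(1) st(1) e(2) out]) (simp add: s_def)
          then have "(s n, e) \<in> I"
            using st e out by (simp add: I_def)
          moreover have "z \<in> B n (s n, e)"
            using z st e by (cases z) (auto simp: B_def s_def)
          moreover have "n < N"
            using tN n by simp
          ultimately show ?thesis by blast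
        qed
      qed
    qed
    then have "?m (space P \<times> Z) \<le> ?m ?C"
      by (rule A.finite_measure_mono_AE[OF _ C_sets])
    also have "\<dots> \<le> ?m (\<Union>x\<in>V. A N x) + ?m (\<Union>n<N. \<Union>i\<in>I. B n i)"
      using finite_V I by (intro measure_Un_le sets.finite_UN A_sets B_sets) auto
    also have "?m (\<Union>x\<in>V. A N x) \<le> (\<Sum>x\<in>V. U N x)"
      unfolding mA[symmetric] using finite_V by (intro measure_UNION_le A_sets)
    also have "?m (\<Union>n<N. \<Union>i\<in>I. B n i) \<le> (\<Sum>n<N. ?m (\<Union>i\<in>I. B n i))"
      using I by (intro measure_UNION_le sets.finite_UN B_sets) auto
    also have "\<dots> \<le> (\<Sum>n<N. \<Sum>i\<in>I. ?m (B n i))"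
      using I by (intro sum_mono measure_UNION_le B_sets)
    also have "\<dots> \<le> (\<Sum>n<N. exit_sum n F)"
    proof (rule sum_mono)
      fix n
      let ?g = "\<lambda>(x, e). if x + e \<in> V then 0 else W n x e * F (x + e)"
      have "(\<Sum>i\<in>I. ?m (B n i)) \<le> (\<Sum>i\<in>I. ?g i)"
      proof (rule sum_mono)
        fix i assume "i \<in> I"
        then obtain x e where i: "i = (x, e)" "e \<in> unit_steps" "x + e \<notin> V" "1 \<le> F (x + e)"
          by (auto simp: I_def)
        have "W n x e * 1 \<le> W n x e * F (x + e)"
          by (intro mult_left_mono i W_nonneg)
        with i show "?m (B n i) \<le> ?g i"
          by (simp add: mB)
      qed
      also have "\<dots> \<le> (\<Sum>i\<in>V \<times> unit_steps. ?g i)"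
        using I_sub finite_V finite_unit_steps
        by (intro sum_mono2) (auto intro!: mult_nonneg_nonneg W_nonneg F)
      also have "\<dots> = exit_sum n F"
        by (simp add: exit_sum_def sum.cartesian_product)
      finally show "(\<Sum>i\<in>I. ?m (B n i)) \<le> exit_sum n F" .
    qed
    also have "\<dots> \<le> F 0"
      by (rule exit_sum_le[OF F super])
    finally show ?thesis by simp
  qed
  \<comment> \<open>The Green function is finite, so the probability of surviving in
    \<open>V\<close> up to time \<open>N\<close> tends to zero.\<close>
  have "(\<lambda>N. F 0 + (\<Sum>x\<in>V. U N x)) \<longlonglongrightarrow> F 0 + (\<Sum>x\<in>V. 0)"
    by (intro tendsto_intros tendsto_sum summable_LIMSEQ_zero summable_U)
  then show ?thesis
    using bound by (intro LIMSEQ_le_const[of _ "F 0"]) auto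
qed

section \<open>Kalikow's chain and its drift\<close>

lemma kalikow_transition_stochastic:
  assumes conn: "lattice_connected V"
  shows "(\<integral>\<^sup>+ y. ennreal (kalikow_transition P V x y) \<partial>count_space UNIV) = 1"
proof (cases "x \<in> V")
  case True
  \<comment> \<open>At sites of \<open>V\<close> Kalikow's chain is a walk in the deterministic
    environment \<open>flow x e / green x\<close>.\<close>
  have "kalikow_transition P V x y = env_transition (\<lambda>x e. flow x e / green x) x y" for y
    using True green_pos[OF conn True]
    by (simp add: kalikow_transition_def env_transition_def kalikow_num_flow kalikow_den_green
        divide_ennreal flow_nonneg)
  moreover have "(\<Sum>e\<in>unit_steps. flow x e / green x) = 1"
    using sum_flow[OF True] green_pos[OF conn True] by (simp add: sum_divide_distrib[symmetric])
  moreover have "0 \<le> flow x e / green x" if "e \<in> unit_steps" for e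
    using flow_nonneg[OF True that] green_pos[OF conn True] by simp
  ultimately show ?thesis
    using env_transition_nn_integral[of "\<lambda>x e. flow x e / green x" x] by simp
next
  case False
  have "(\<integral>\<^sup>+ y. ennreal (kalikow_transition P V x y) \<partial>count_space UNIV) =
      (\<Sum>y\<in>{x}. ennreal (kalikow_transition P V x y))"
    by (rule nn_integral_count_space') (use False in \<open>auto simp: kalikow_transition_def\<close>)
  then show ?thesis
    using False by (simp add: kalikow_transition_def)
qed

text \<open>The drift is an integral over path space, but almost surely the first step is one of
  finitely many unit steps, and the integrand is then a finite sum of indicators.\<close>

lemma kalikow_drift_eq:
  assumes conn: "lattice_connected V" and x: "x \<in> V"
  shows "kalikow_drift P V x = (\<Sum>e\<in>unit_steps. (flow x e / green x) *\<^sub>R of_lattice e)"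
proof -
  define Q where "Q = markov_law (kalikow_transition P V) x"
  note stoch = kalikow_transition_stochastic[OF conn]
  interpret Q: prob_space Q
    unfolding Q_def by (rule prob_space_markov_law[OF stoch])
  have sets_Q: "sets Q = sets path_space"
    unfolding Q_def by (rule prob_space_markov_law[OF stoch])
  define A where "A e = {s :: nat \<Rightarrow> int ^ 'd. \<forall>i\<le>1. s i = (if i = 0 then x else x + e)}" for e
  have A_iff: "s \<in> A e \<longleftrightarrow> s 0 = x \<and> s 1 = x + e" for s e
    by (auto simp: A_def le_Suc_eq)
  have A_sets: "A e \<in> sets Q" for e
    unfolding A_def sets_Q by (rule cylinder_sets)
  have mA: "Q.prob (A e) = flow x e / green x" if e: "e \<in> unit_steps" for e
  proof -
    have "emeasure Q (A e) = ennreal (kalikow_transition P V x (x + e))"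
      unfolding Q_def A_def by (subst emeasure_markov_law[OF stoch]) simp
    also have "\<dots> = ennreal (flow x e / green x)"
      using x e green_pos[OF conn x]
      by (simp add: kalikow_transition_def kalikow_num_flow kalikow_den_green divide_ennreal flow_nonneg)
    finally show ?thesis
      using flow_nonneg[OF x e] green_pos[OF conn x] by (simp add: Q.emeasure_eq_measure)
  qed
  have "Q.prob (\<Union>e\<in>unit_steps. A e) = (\<Sum>e\<in>unit_steps. Q.prob (A e))"
    by (rule Q.finite_measure_finite_Union)
       (auto simp: finite_unit_steps A_sets disjoint_family_on_def A_iff)
  also have "\<dots> = 1"
    using sum_flow[OF x] green_pos[OF conn x] by (simp add: mA sum_divide_distrib[symmetric])
  finally have AE: "AE s in Q. s \<in> (\<Union>e\<in>unit_steps. A e)"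
    by (rule Q.AE_prob_1)
  have comp: "(\<lambda>s. s i) \<in> measurable Q (count_space UNIV)" for i
    unfolding measurable_cong_sets[OF sets_Q refl] by (rule measurable_component_singleton) simp
  have meas: "(\<lambda>s. of_lattice (s 1 - s 0)) \<in> borel_measurable Q"
  \<comment> \<open>Freezing the value \<open>a\<close> of \<open>s 1\<close>, one of countably
    many, leaves a function of the single coordinate \<open>s 0\<close>.\<close>
  proof (rule measurable_compose_countable[where f="\<lambda>a s. of_lattice (a - s 0)" and g="\<lambda>s. s 1", OF _ comp])
    show "(\<lambda>s. of_lattice (a - s 0)) \<in> borel_measurable Q" for a
      by (rule measurable_compose[OF comp]) simp
  qed
  have ind: "integrable Q (\<lambda>s. indicator (A e) s :: real)" for e
    using A_sets by (simp add: Q.emeasure_eq_measure)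
  have "kalikow_drift P V x = (\<integral>s. of_lattice (s 1 - s 0) \<partial>Q)"
    by (simp add: kalikow_drift_def Q_def)
  also have "\<dots> = (\<integral>s. (\<Sum>e\<in>unit_steps. indicator (A e) s *\<^sub>R of_lattice e) \<partial>Q)"
  proof (rule integral_cong_AE[OF meas])
    show "(\<lambda>s. \<Sum>e\<in>unit_steps. indicator (A e) s *\<^sub>R of_lattice e) \<in> borel_measurable Q"
      by (intro borel_measurable_sum borel_measurable_scaleR borel_measurable_indicator A_sets
          borel_measurable_const)
    show "AE s in Q. of_lattice (s 1 - s 0) = (\<Sum>e\<in>unit_steps. indicator (A e) s *\<^sub>R of_lattice e)"
      using AE
    proof eventually_elim
      fix s assume "s \<in> (\<Union>e\<in>unit_steps. A e)"
      then obtain e where e: "e \<in> unit_steps" "s 0 = x" "s 1 = x + e"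
        by (auto simp: A_iff)
      have "(\<Sum>e'\<in>unit_steps. indicator (A e') s *\<^sub>R of_lattice e') =
          (\<Sum>e'\<in>unit_steps. if e' = e then of_lattice e' else 0)"
        using e by (intro sum.cong refl) (auto simp: indicator_def A_iff)
      then show "of_lattice (s 1 - s 0) = (\<Sum>e'\<in>unit_steps. indicator (A e') s *\<^sub>R of_lattice e')"
        using e by (simp add: finite_unit_steps)
    qed
  qed
  also have "\<dots> = (\<Sum>e\<in>unit_steps. \<integral>s. indicator (A e) s *\<^sub>R of_lattice e \<partial>Q)"
    by (rule Bochner_Integration.integral_sum) (rule integrable_scaleR_left[OF ind])
  also have "\<dots> = (\<Sum>e\<in>unit_steps. (flow x e / green x) *\<^sub>R of_lattice e)"
  proof (intro sum.cong refl)
    fix e :: "int ^ 'd" assume "e \<in> unit_steps"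
    then show "(\<integral>s. indicator (A e) s *\<^sub>R of_lattice e \<partial>Q) = (flow x e / green x) *\<^sub>R of_lattice e"
      using integral_scaleR_left[of "of_lattice e" Q "indicator (A e)"] ind[of e] A_sets[of e] mA[of e] by simp
  qed
  finally show ?thesis .
qed

text \<open>With \<open>norm q \<le> \<delta> / 4\<close> the quadratic error \<open>(\<delta> / 4)\<^sup>2\<close> and the transversal drift, at most
  \<open>\<delta>\<^sup>2 / 16\<close>, exactly balance the gain \<open>\<delta>\<^sup>2 / 8\<close> from the drift along \<open>l\<close>.\<close>

lemma exp_superharmonic:
  fixes l v :: "real ^ 'd"
  assumes conn: "lattice_connected V" and x: "x \<in> V"
    and drift: "\<delta> \<le> kalikow_drift P V x \<bullet> l" and \<delta>: "0 < \<delta>" "\<delta> \<le> 1"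
    and l: "norm l = 1" and v: "norm v \<le> 1"
  defines "q \<equiv> (\<delta>\<^sup>2 / 16) *\<^sub>R v - (\<delta> / 8) *\<^sub>R l"
  shows "(\<Sum>e\<in>unit_steps. flow x e * (exp (q \<bullet> of_lattice (x + e)) - exp (q \<bullet> of_lattice x))) \<le> 0"
proof -
  let ?D = "kalikow_drift P V x"
  have G: "0 < green x" by (rule green_pos[OF conn x])
  have unit: "norm (of_lattice e) = 1" if "e \<in> unit_steps" for e :: "int ^ 'd"
    using that by (simp add: unit_steps_def)
  have "norm q \<le> norm ((\<delta>\<^sup>2 / 16) *\<^sub>R v) + norm ((\<delta> / 8) *\<^sub>R l)"
    unfolding q_def by (rule norm_triangle_ineq4)
  also have "\<dots> \<le> \<delta>\<^sup>2 / 16 * 1 + \<delta> / 8 * 1"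
    using v l \<delta> by simp
  also have "\<dots> \<le> \<delta> / 4"
    using mult_left_mono[OF \<delta>(2), of \<delta>] \<delta>(1) unfolding power2_eq_square by linarith
  finally have q: "norm q \<le> \<delta> / 4" .
  \<comment> \<open>The drift is a convex combination of unit vectors.\<close>
  have "norm ?D \<le> (\<Sum>e\<in>unit_steps. norm ((flow x e / green x) *\<^sub>R of_lattice e :: real ^ 'd))"
    unfolding kalikow_drift_eq[OF conn x] by (rule norm_sum)
  also have "\<dots> = (\<Sum>e\<in>unit_steps. flow x e / green x)"
    using G by (intro sum.cong refl) (auto simp: flow_nonneg x unit)
  also have "\<dots> = 1"
    using sum_flow[OF x] G by (simp add: sum_divide_distrib[symmetric])
  finally have D: "norm ?D \<le> 1" .
  have "v \<bullet> ?D \<le> norm v * norm ?D"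
    by (rule norm_cauchy_schwarz)
  also have "\<dots> \<le> 1"
    using v D by (intro mult_le_one) auto
  finally have vD: "v \<bullet> ?D \<le> 1" .
  have "q \<bullet> ?D = \<delta>\<^sup>2 / 16 * (v \<bullet> ?D) - \<delta> / 8 * (?D \<bullet> l)"
    by (simp add: q_def inner_diff_left inner_commute[of l] inner_commute[of v])
  also have "\<dots> \<le> \<delta>\<^sup>2 / 16 * 1 - \<delta> / 8 * \<delta>"
    using vD drift \<delta> by (intro diff_mono mult_left_mono) auto
  finally have qD: "q \<bullet> ?D + (\<delta> / 4)\<^sup>2 \<le> 0"
    by (simp add: power2_eq_square)
  \<comment> \<open>With the value at \<open>x\<close> factored out, each increment is at most a
    linear term, which sums to the drift, plus a uniform quadratic error.\<close>
  have "(\<Sum>e\<in>unit_steps. flow x e * (exp (q \<bullet> of_lattice (x + e)) - exp (q \<bullet> of_lattice x))) \<le>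
      (\<Sum>e\<in>unit_steps. flow x e * (exp (q \<bullet> of_lattice x) * (q \<bullet> of_lattice e + (\<delta> / 4)\<^sup>2)))"
  proof (intro sum_mono mult_left_mono)
    fix e :: "int ^ 'd" assume e: "e \<in> unit_steps"
    have "\<bar>q \<bullet> of_lattice e\<bar> \<le> norm q * norm (of_lattice e)"
      by (rule Cauchy_Schwarz_ineq2)
    also have "\<dots> \<le> \<delta> / 4"
      using q unit[OF e] by simp
    finally have qe: "\<bar>q \<bullet> of_lattice e\<bar> \<le> \<delta> / 4" .
    then have "exp (q \<bullet> of_lattice e) \<le> 1 + q \<bullet> of_lattice e + (q \<bullet> of_lattice e)\<^sup>2"
      using \<delta> by (intro exp_le_quadratic) simp
    also have "(q \<bullet> of_lattice e)\<^sup>2 \<le> (\<delta> / 4)\<^sup>2"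
      using power_mono[OF qe, of 2] by simp
    finally have "exp (q \<bullet> of_lattice x) * (exp (q \<bullet> of_lattice e) - 1) \<le>
        exp (q \<bullet> of_lattice x) * (q \<bullet> of_lattice e + (\<delta> / 4)\<^sup>2)"
      by (intro mult_left_mono) auto
    then show "exp (q \<bullet> of_lattice (x + e)) - exp (q \<bullet> of_lattice x) \<le>
        exp (q \<bullet> of_lattice x) * (q \<bullet> of_lattice e + (\<delta> / 4)\<^sup>2)"
      by (simp add: of_lattice_add exp_add algebra_simps)
    show "0 \<le> flow x e"
      by (rule flow_nonneg[OF x e])
  qed
  also have "\<dots> = exp (q \<bullet> of_lattice x) *
      (\<Sum>e\<in>unit_steps. flow x e * (q \<bullet> of_lattice e) + flow x e * (\<delta> / 4)\<^sup>2)"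
    by (simp add: sum_distrib_left algebra_simps)
  also have "(\<Sum>e\<in>unit_steps. flow x e * (q \<bullet> of_lattice e) + flow x e * (\<delta> / 4)\<^sup>2) =
      green x * (q \<bullet> ?D + (\<delta> / 4)\<^sup>2)"
    using G unfolding sum.distrib sum_distrib_right[symmetric] sum_flow[OF x] kalikow_drift_eq[OF conn x]
    by (simp add: inner_sum_right distrib_left sum_distrib_left)
  also have "exp (q \<bullet> of_lattice x) * (green x * (q \<bullet> ?D + (\<delta> / 4)\<^sup>2)) \<le> 0"
    using G qD by (intro mult_nonneg_nonpos) auto
  finally show ?thesis .
qed

end

section \<open>Rotated boxes and the component of the origin\<close>

lemma rotation_matrix_inner:
  fixes A :: "real ^ 'n ^ 'n"
  assumes "rotation_matrix A"
  shows "(A *v x) \<bullet> (A *v y) = x \<bullet> y"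
proof -
  have "orthogonal_transformation ((*v) A)"
    using assms by (simp add: orthogonal_transformation_matrix rotation_matrix_def)
  then show ?thesis
    by (simp add: orthogonal_transformation_def)
qed

text \<open>A rotation preserves inner products, so box coordinates are inner products with the
  rotated axes. Each face thus becomes a bound on a linear functional, as the exponential functions
  require.\<close>

lemma lattice_box_iff:
  fixes R :: "real ^ 'd::finite \<Rightarrow> real ^ 'd ^ 'd"
  assumes "rotation_matrix (R u)"
  shows "z \<in> lattice_box k R L L' u 0 \<longleftrightarrow>
     \<bar>of_lattice z \<bullet> (R u *v axis k 1)\<bar> < L \<and> (\<forall>j. j \<noteq> k \<longrightarrow> \<bar>of_lattice z \<bullet> (R u *v axis j 1)\<bar> < L')"
proof -
  let ?w = "transpose (R u) *v of_lattice z"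
  have abs_less: "a \<in> {- b<..<b} \<longleftrightarrow> \<bar>a\<bar> < b" for a b :: real
    by auto
  have w: "R u *v ?w = of_lattice z"
    using assms by (simp add: matrix_vector_mul_assoc rotation_matrix_def orthogonal_matrix_def
        del: transpose_matrix_vector)
  have nth: "w $ j = of_lattice z \<bullet> (R u *v axis j 1)" if "of_lattice z = R u *v w" for w j
    unfolding that rotation_matrix_inner[OF assms] by (simp add: inner_axis)
  have "z \<in> lattice_box k R L L' u 0 \<longleftrightarrow>
      ?w $ k \<in> {-L<..<L} \<and> (\<forall>j. j \<noteq> k \<longrightarrow> ?w $ j \<in> {-L'<..<L'})"
  proof
    assume "z \<in> lattice_box k R L L' u 0"
    then obtain w where *: "w $ k \<in> {-L<..<L}" "\<forall>j. j \<noteq> k \<longrightarrow> w $ j \<in> {-L'<..<L'}"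
      "of_lattice z = R u *v w"
      by (auto simp: lattice_box_def)
    have "w = ?w"
      unfolding vec_eq_iff by (intro allI trans[OF nth[OF *(3)] nth[OF w[symmetric], symmetric]])
    then show "?w $ k \<in> {-L<..<L} \<and> (\<forall>j. j \<noteq> k \<longrightarrow> ?w $ j \<in> {-L'<..<L'})"
      using *(1,2) by (simp only:)
  next
    assume "?w $ k \<in> {-L<..<L} \<and> (\<forall>j. j \<noteq> k \<longrightarrow> ?w $ j \<in> {-L'<..<L'})"
    then show "z \<in> lattice_box k R L L' u 0"
      unfolding lattice_box_def using w by (intro CollectI exI[of _ ?w]) simp
  qed
  then show ?thesis
    unfolding abs_less nth[OF w[symmetric]] .
qed

lemma finite_lattice_box:
  fixes R :: "real ^ 'd::finite \<Rightarrow> real ^ 'd ^ 'd"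
  assumes "rotation_matrix (R u)"
  shows "finite (lattice_box k R L L' u 0)"
proof (rule finite_subset[OF _ finite_lattice_bounded])
  let ?B = "real CARD('d) * max L L'"
  show "lattice_box k R L L' u 0 \<subseteq> {z. \<forall>i. \<bar>z $ i\<bar> \<le> \<lceil>?B\<rceil>}"
  proof safe
    fix z i assume "z \<in> lattice_box k R L L' u 0"
    then obtain w where *: "w $ k \<in> {-L<..<L}" "\<forall>j. j \<noteq> k \<longrightarrow> w $ j \<in> {-L'<..<L'}"
      "of_lattice z = R u *v w"
      by (auto simp: lattice_box_def)
    have "\<bar>of_lattice z $ i\<bar> \<le> norm (of_lattice z)"
      by (rule component_le_norm_cart)
    also have "\<dots> = norm w"
      unfolding norm_eq_sqrt_inner *(3) rotation_matrix_inner[OF assms] ..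
    also have "\<dots> \<le> (\<Sum>j\<in>UNIV. \<bar>w $ j\<bar>)"
      by (rule norm_le_l1_cart)
    also have "\<dots> \<le> (\<Sum>j\<in>(UNIV :: 'd set). max L L')"
    proof (rule sum_mono)
      fix j show "\<bar>w $ j\<bar> \<le> max L L'"
        using * by (cases "j = k") (auto simp: abs_le_iff less_max_iff_disj le_max_iff_disj min_def)
    qed
    finally have "real_of_int \<bar>z $ i\<bar> \<le> ?B"
      by (simp add: of_lattice_def)
    then show "\<bar>z $ i\<bar> \<le> \<lceil>?B\<rceil>"
      by linarith
  qed
qed

text \<open>The lattice points of a rotated box need not be connected (they may be isolated near a
  corner), so Kalikow's condition is applied to the component of the origin, from which the walk
  exits exactly when it exits from the box.\<close>

definition origin_component :: "(int ^ 'd) set \<Rightarrow> (int ^ 'd) set" where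
  "origin_component B = {x. (0, x) \<in> {(a, b). a \<in> B \<and> b \<in> B \<and> b - a \<in> unit_steps}\<^sup>*}"

lemma origin_component_step:
  assumes "x \<in> origin_component B" "e \<in> unit_steps" "x \<in> B" "x + e \<in> B"
  shows "x + e \<in> origin_component B"
  using assms unfolding origin_component_def by (auto intro: rtrancl_into_rtrancl)

lemma zero_in_origin_component: "0 \<in> origin_component B"
  by (simp add: origin_component_def)

text \<open>The reflexive closure puts the origin into the component even when it is not in
  \<open>B\<close>, whence the hypothesis.\<close>

lemma origin_component_subset:
  assumes "0 \<in> B" shows "origin_component B \<subseteq> B"
proof
  fix x assume "x \<in> origin_component B"
  then have "(0, x) \<in> {(a, b). a \<in> B \<and> b \<in> B \<and> b - a \<in> unit_steps}\<^sup>*"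
    by (simp add: origin_component_def)
  then show "x \<in> B"
    by (cases rule: rtranclE) (use assms in auto)
qed

lemma minus_unit_steps: "- e \<in> unit_steps \<longleftrightarrow> e \<in> unit_steps"
  by (simp add: unit_steps_iff)

text \<open>Every point on a path in \<open>B\<close> from the origin lies in the component itself.
  Steps can be reversed, so any two points are joined through the origin.\<close>

lemma lattice_connected_origin_component: "lattice_connected (origin_component B)"
proof -
  define E where "E V = {(a, b). a \<in> V \<and> b \<in> V \<and> b - a \<in> unit_steps}" for V :: "(int ^ 'a) set"
  let ?V = "origin_component B"
  have V: "x \<in> ?V \<longleftrightarrow> (0, x) \<in> (E B)\<^sup>*" for x
    by (simp add: origin_component_def E_def)
  have "sym (E ?V)"
  proof (rule symI)
    fix a b assume "(a, b) \<in> E ?V"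
    then show "(b, a) \<in> E ?V"
      using minus_unit_steps[of "b - a"] by (simp add: E_def)
  qed
  then have sym: "sym ((E ?V)\<^sup>*)"
    by (rule sym_rtrancl)
  have reach: "(0, x) \<in> (E ?V)\<^sup>*" if "x \<in> ?V" for x
  proof -
    from that have "(0, x) \<in> (E B)\<^sup>*" by (simp only: V)
    then show ?thesis
    proof (induction rule: rtrancl_induct)
      case (step y z)
      have "y \<in> ?V" "z \<in> ?V"
        using step(1,2) unfolding V by (auto intro: rtrancl_into_rtrancl)
      with step(2) have "(y, z) \<in> E ?V"
        by (simp add: E_def)
      with step(3) show ?case
        by (rule rtrancl_into_rtrancl)
    qed simp
  qed
  have "(x, y) \<in> (E ?V)\<^sup>*" if "x \<in> ?V" "y \<in> ?V" for x y
    using symD[OF sym reach[OF that(1)]] reach[OF that(2)] by (rule rtrancl_trans)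
  then show ?thesis
    by (simp add: lattice_connected_def E_def)
qed

text \<open>Makes a finite domain a strict subset of the lattice, as Kalikow's condition
  demands.\<close>

lemma infinite_lattice: "infinite (UNIV :: (int ^ 'd::finite) set)"
proof -
  have "inj (\<lambda>n. vec (int n) :: int ^ 'd)"
    by (simp add: inj_on_def vec_eq_iff)
  then have "infinite (range (\<lambda>n. vec (int n) :: int ^ 'd))"
    by (rule range_inj_infinite)
  then show ?thesis
    by (rule infinite_super[OF subset_UNIV])
qed

text \<open>One exponential for each \<open>v\<close> in \<open>T\<close> is summed, so that a
  single superharmonic \<open>F\<close> handles all bad exits: \<open>0\<close> serves the back, the
  signed rotated axes serve the sides. With \<open>c = \<delta> / 8\<close> and
  \<open>a = \<delta>\<^sup>2 / 16\<close> the ratio \<open>4 / \<delta>\<close> is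
  \<open>2 * c / a\<close>: at a side the transversal gain of at least \<open>2 * c * M\<close> pays
  for a loss along \<open>l\<close> of at most \<open>c * M\<close>.\<close>

lemma (in rwre) bad_exit_prob_le:
  fixes l :: "real ^ 'd" and R :: "real ^ 'd \<Rightarrow> real ^ 'd ^ 'd"
  assumes rot: "rotation_matrix (R l)" and Rk: "R l *v axis k 1 = l" and l: "norm l = 1"
    and \<delta>: "0 < \<delta>" "\<delta> \<le> 1"
    and drift: "\<And>V x. lattice_connected V \<Longrightarrow> V \<subset> UNIV \<Longrightarrow> 0 \<in> V \<Longrightarrow> x \<in> V \<Longrightarrow>
      \<delta> \<le> kalikow_drift P V x \<bullet> l"
    and M: "0 < M"
  defines "T \<equiv> insert 0 (range (\<lambda>j. R l *v axis j 1) \<union> range (\<lambda>j. - (R l *v axis j 1)))"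
  shows "bad_exit_prob P k R M (4 / \<delta> * M) l \<le> real (card T) * exp (- (\<delta> / 8 * M))"
proof -
  define B where "B = lattice_box k R M (4 / \<delta> * M) l 0"
  define V where "V = origin_component B"
  let ?u = "\<lambda>j. R l *v axis j 1"
  have norm_u: "norm (?u j) = 1" for j
    unfolding norm_eq_sqrt_inner rotation_matrix_inner[OF rot] by (simp add: inner_axis_axis)
  have fin_T: "finite T"
    by (simp add: T_def)
  have norm_T: "norm v \<le> 1" if "v \<in> T" for v
    using that norm_u by (auto simp: T_def)
  have B_iff: "z \<in> B \<longleftrightarrow> \<bar>of_lattice z \<bullet> l\<bar> < M \<and> (\<forall>j. j \<noteq> k \<longrightarrow> \<bar>of_lattice z \<bullet> ?u j\<bar> < 4 / \<delta> * M)" for z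
    unfolding B_def lattice_box_iff[where R=R and u=l, OF rot] Rk ..
  have "0 \<in> B"
    using M \<delta> by (simp add: B_iff)
  then have VB: "V \<subseteq> B"
    unfolding V_def by (rule origin_component_subset)
  have fin_V: "finite V"
    by (rule finite_subset[OF VB]) (simp only: B_def finite_lattice_box[where R=R and u=l, OF rot])
  interpret rwre_domain P \<kappa> V
  proof
    show "finite V" by (rule fin_V)
    show "0 \<in> V" unfolding V_def by (rule zero_in_origin_component)
  qed
  have conn: "lattice_connected V"
    unfolding V_def by (rule lattice_connected_origin_component)
  have proper: "V \<subset> UNIV"
    using fin_V infinite_lattice by auto
  define q where "q v = (\<delta>\<^sup>2 / 16) *\<^sub>R v - (\<delta> / 8) *\<^sub>R l" for v
  define F where "F y = (\<Sum>v\<in>T. exp (- (\<delta> / 8 * M)) * exp (q v \<bullet> of_lattice y))" for y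
  define Z where "Z = {s. \<not> exits_through B (front_boundary k R M (4 / \<delta> * M) l 0) s}"
  have F_ge: "1 \<le> F y" if "v \<in> T" "\<delta> / 8 * M \<le> q v \<bullet> of_lattice y" for v y
  proof -
    have "1 \<le> exp (- (\<delta> / 8 * M)) * exp (q v \<bullet> of_lattice y)"
      using that(2) by (simp add: exp_add[symmetric])
    also have "\<dots> \<le> F y"
      unfolding F_def by (rule member_le_sum[OF that(1)]) (auto simp: fin_T)
    finally show ?thesis .
  qed
  have "measure (annealed P 0) (space P \<times> Z) \<le> F 0"
  proof (rule exit_prob_le)
    fix s n x e
    assume s: "s \<in> Z" "x \<in> V" "e \<in> unit_steps" "s \<in> staying V n x" "s (Suc n) = x + e" "x + e \<notin> V"
    let ?y = "of_lattice (x + e)"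
    \<comment> \<open>A unit step from \<open>x\<close> to a point of \<open>B\<close> would stay in
      the component.\<close>
    have out: "x + e \<notin> B"
      using s VB origin_component_step[of x B e] by (auto simp: V_def)
    have "exit_time B s = enat (Suc n)"
    proof (rule antisym)
      show "exit_time B s \<le> enat (Suc n)"
        unfolding exit_time_def by (rule INF_lower) (use s out in simp)
      show "enat (Suc n) \<le> exit_time B s"
        unfolding le_exit_time_iff using s(4) VB by (auto simp: staying_def)
    qed
    \<comment> \<open>The exit point is one unit step from \<open>x\<close>, hence in the boundary
      of \<open>B\<close>. Since \<open>Z\<close> forbids the front, its height along
      \<open>l\<close> must stay below \<open>M\<close>.\<close>
    moreover have "x + e \<in> front_boundary k R M (4 / \<delta> * M) l 0" if "M \<le> ?y \<bullet> l"
      unfolding front_boundary_def boundary_def B_def[symmetric]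
      using out that s(2) VB norm1_unit_steps[OF s(3)] by (auto intro!: bexI[of _ x])
    ultimately have front: "?y \<bullet> l < M"
      using s(1,5) unfolding Z_def exits_through_def by (simp add: not_less[symmetric]) blast
    have qy: "q v \<bullet> ?y = \<delta>\<^sup>2 / 16 * (?y \<bullet> v) - \<delta> / 8 * (?y \<bullet> l)" for v
      by (simp add: q_def inner_diff_left inner_commute[of l] inner_commute[of v])
    consider "M \<le> \<bar>?y \<bullet> l\<bar>" | j where "4 / \<delta> * M \<le> \<bar>?y \<bullet> ?u j\<bar>"
      using out unfolding B_iff by (meson not_less)
    then show "1 \<le> F (x + e)"
    proof cases
      case 1
      with front have "?y \<bullet> l \<le> - M"
        by linarith
      then have "\<delta> / 8 * (?y \<bullet> l) \<le> \<delta> / 8 * (- M)"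
        using \<delta> by (intro mult_left_mono) auto
      then show ?thesis
        by (intro F_ge[of 0]) (simp_all add: T_def qy)
    next
      case 2
      have side: "\<delta> / 8 * M \<le> q v \<bullet> ?y" if "4 / \<delta> * M \<le> ?y \<bullet> v" for v
      proof -
        have "\<delta> / 4 * M = \<delta>\<^sup>2 / 16 * (4 / \<delta> * M)"
          using \<delta> by (simp add: power2_eq_square)
        also have "\<dots> \<le> \<delta>\<^sup>2 / 16 * (?y \<bullet> v)"
          using that by (intro mult_left_mono) auto
        finally have "\<delta> / 4 * M \<le> \<delta>\<^sup>2 / 16 * (?y \<bullet> v)" .
        moreover have "\<delta> / 8 * (?y \<bullet> l) \<le> \<delta> / 8 * M"
          using front \<delta> by (intro mult_left_mono) auto
        ultimately show ?thesis
          unfolding qy by linarith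
      qed
      show ?thesis
      proof (cases "0 \<le> ?y \<bullet> ?u j")
        case True
        with 2 show ?thesis
          by (intro F_ge[of "?u j"] side) (auto simp: T_def)
      next
        case False
        with 2 show ?thesis
          by (intro F_ge[of "- ?u j"] side) (auto simp: T_def)
      qed
    qed
  next
    show "0 \<le> F x" for x
      by (simp add: F_def sum_nonneg)
  next
    fix x assume x: "x \<in> V"
    let ?h = "\<lambda>v e. flow x e * (exp (q v \<bullet> of_lattice (x + e)) - exp (q v \<bullet> of_lattice x))"
    have "(\<Sum>e\<in>unit_steps. flow x e * (F (x + e) - F x)) =
        (\<Sum>e\<in>unit_steps. \<Sum>v\<in>T. exp (- (\<delta> / 8 * M)) * ?h v e)"
      unfolding F_def sum_subtractf[symmetric] sum_distrib_left
      by (simp add: algebra_simps)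
    also have "\<dots> = (\<Sum>v\<in>T. exp (- (\<delta> / 8 * M)) * (\<Sum>e\<in>unit_steps. ?h v e))"
      by (subst sum.swap) (simp only: sum_distrib_left)
    also have "\<dots> \<le> 0"
      unfolding q_def
      by (intro sum_nonpos mult_nonneg_nonpos
          exp_superharmonic[OF conn x drift[OF conn proper zero_in_V x] \<delta> l norm_T]) auto
    finally show "(\<Sum>e\<in>unit_steps. flow x e * (F (x + e) - F x)) \<le> 0" .
  qed
  moreover have "F 0 = real (card T) * exp (- (\<delta> / 8 * M))"
    by (simp add: F_def)
  moreover have "bad_exit_prob P k R M (4 / \<delta> * M) l = measure (annealed P 0) (space P \<times> Z)"
    unfolding bad_exit_prob_def space_annealed Z_def B_def
    by (rule arg_cong[where f="measure _"]) auto
  ultimately show ?thesis by simp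
qed

text \<open>Half of the rate absorbs the constant: \<open>ln K\<close> is at most
  \<open>c / 2 * M\<close> once \<open>M\<close> exceeds \<open>2 * ln K / c\<close>.\<close>

lemma Limsup_ln_ereal_neg:
  fixes p :: "real \<Rightarrow> real"
  assumes p: "\<And>M. 0 < M \<Longrightarrow> p M \<le> K * exp (- (c * M))" "\<And>M. 0 \<le> p M" and c: "0 < c"
  shows "Limsup at_top (\<lambda>M. ereal (1 / M) * ln_ereal (p M)) < 0"
proof -
  have "eventually (\<lambda>M. ereal (1 / M) * ln_ereal (p M) \<le> ereal (- (c / 2))) at_top"
    using eventually_gt_at_top[of 0] eventually_ge_at_top[of "2 * ln K / c"]
  proof eventually_elim
    case (elim M)
    show ?case
    proof (cases "p M = 0")
      case True
      with elim show ?thesis by (simp add: ln_ereal_def)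
    next
      case False
      with p(2)[of M] have pM: "0 < p M" by simp
      \<comment> \<open>A positive probability forces \<open>K\<close> to be positive, so
        \<open>ln K\<close> is a genuine logarithm here.\<close>
      then have "0 < K * exp (- (c * M))"
        using p(1)[OF elim(1)] by linarith
      then have K: "0 < K" by (simp add: zero_less_mult_iff)
      have "ln (p M) \<le> ln (K * exp (- (c * M)))"
        using p(1)[OF elim(1)] pM by simp
      also have "\<dots> = ln K - c * M"
        using K by (simp add: ln_mult)
      also have "\<dots> \<le> - (c / 2) * M"
        using elim c by (simp add: field_simps)
      finally have "ln (p M) / M \<le> - (c / 2)"
        using elim by (simp add: divide_le_eq)
      with False show ?thesis by (simp add: ln_ereal_def)
    qed
  qed
  then have "Limsup at_top (\<lambda>M. ereal (1 / M) * ln_ereal (p M)) \<le> ereal (- (c / 2))"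
    by (rule Limsup_bounded)
  also have "\<dots> < 0"
    using c by simp
  finally show ?thesis .
qed

theorem proposition6p2:
  fixes \<kappa> :: real
    and P :: "'d::finite env measure"
    and k :: 'd
    and R :: "real ^ 'd \<Rightarrow> real ^ 'd ^ 'd"
    and l :: "real ^ 'd"
  assumes "CARD('d) > 1"
    and "0 < \<kappa>" and "\<kappa> \<le> 1 / (4 * real CARD('d))"
    and "prob_space P" and "sets P = sets (env_space \<kappa>)"
    and "\<And>u. u \<in> sphere 0 1 \<Longrightarrow> rotation_matrix (R u) \<and> R u *v axis k 1 = u"
    and "l \<in> sphere 0 1"
    and "kalikow_condition P l"
  shows "condition_T P k R l"
proof -
  interpret prob_space P by fact
  interpret rwre P \<kappa>
    by unfold_locales fact+
  obtain \<delta>' where \<delta>': "0 < \<delta>'"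
    "ereal \<delta>' < (INF (V, x)\<in>{(V, x). lattice_connected V \<and> V \<subset> UNIV \<and> 0 \<in> V \<and> x \<in> V}.
               ereal (kalikow_drift P V x \<bullet> l))"
    using assms(8) by (auto simp: kalikow_condition_def)
  \<comment> \<open>The exponential estimate requires \<open>\<delta> \<le> 1\<close>, and lowering
    a lower bound on the drift keeps it valid.\<close>
  define \<delta> where "\<delta> = min \<delta>' 1"
  have \<delta>: "0 < \<delta>" "\<delta> \<le> 1"
    using \<delta>' by (auto simp: \<delta>_def)
  have drift: "\<delta> \<le> kalikow_drift P V x \<bullet> l"
    if "lattice_connected V" "V \<subset> UNIV" "0 \<in> V" "x \<in> V" for V x
  proof -
    have "ereal \<delta>' < ereal (kalikow_drift P V x \<bullet> l)"
      by (rule less_le_trans[OF \<delta>'(2)], rule INF_lower2[of "(V, x)"]) (use that in auto)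
    then show ?thesis by (simp add: \<delta>_def)
  qed
  have R: "rotation_matrix (R l)" "R l *v axis k 1 = l" and l: "norm l = 1"
    using assms(6)[OF assms(7)] assms(7) by auto
  show ?thesis
    unfolding condition_T_def
  proof (intro exI[of _ "4 / \<delta>"] conjI)
    show "0 < 4 / \<delta>"
      using \<delta> by simp
    show "Limsup at_top (\<lambda>M. ereal (1 / M) * ln_ereal (bad_exit_prob P k R M (4 / \<delta> * M) l)) < 0"
      by (rule Limsup_ln_ereal_neg[OF bad_exit_prob_le[where R=R and l=l, OF R l \<delta> drift]])
         (use \<delta> in \<open>simp_all add: bad_exit_prob_def\<close>)
  qed
qed

end
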